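(* Let $\mathbf{k}$ be a field, let $(A,\cdot_1,\circ,\mathcal{B}(\cdot,\cdot))$ be a finite-dimensional quadratic Jacobi Novikov-Poisson algebra over $\mathbf{k}$ and let $(B,\cdot_2,\diamond,(\cdot,\cdot))$ be a finite-dimensional quadratic right Jacobi Novikov-Poisson algebra over $\mathbf{k}$. Let $J=A\otimes B$ be the Jacobi algebra with operations $$(a_1\otimes a_2)\cdot(b_1\otimes b_2)=a_1\cdot_1 b_1\otimes a_2\cdot_2 b_2,\qquad [a_1\otimes a_2,b_1\otimes b_2]=a_1\circ b_1\otimes a_2\diamond b_2-b_1\circ a_1\otimes b_2\diamond a_2.$$ Define a bilinear form $(\cdot,\cdot)_J$ on $J$ by $$(a_1\otimes a_2,b_1\otimes b_2)_J=\mathcal{B}(a_1,b_1)\,(a_2,b_2)\qquad\text{for all } a_1,b_1\in A,\ a_2,b_2\in B.$$ Then $(J,\cdot,[\cdot,\cdot],(\cdot,\cdot)_J)$ is a Frobenius Jacobi algebra.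
   Context: All vector spaces, algebras and tensor products are over $\mathbf{k}$; binary operations are bilinear. A Novikov algebra $(A,\circ)$ is a vector space with a binary operation satisfying $(a\circ b)\circ c-a\circ(b\circ c)=(b\circ a)\circ c-b\circ(a\circ c)$ and $(a\circ b)\circ c=(a\circ c)\circ b$. A Jacobi Novikov-Poisson algebra is a triple $(A,\cdot,\circ)$ where $(A,\cdot)$ is a unital commutative associative algebra with identity $1_A$, $(A,\circ)$ is a Novikov algebra, and $(a\cdot b)\circ c=a\cdot(b\circ c)$, $c\circ(a\cdot b)=(c\circ a)\cdot b+a\cdot(c\circ b)-a\cdot b\cdot(c\circ 1_A)$ for all $a,b,c\in A$. A quadratic Jacobi Novikov-Poisson algebra is $(A,\cdot,\circ,\mathcal{B}(\cdot,\cdot))$ with $(A,\cdot,\circ)$ a Jacobi Novikov-Poisson algebra and $\mathcal{B}$ a nondegenerate symmetric bilinear form with $\mathcal{B}(a\cdot b,c)=\mathcal{B}(a,b\cdot c)$ and $\mathcal{B}(a\circ b,c)=-\mathcal{B}(b,a\circ c+c\circ a)$ for all $a,b,c$. A quadratic right Jacobi Novikov-Poisson algebra is $(B,\cdot,\diamond,(\cdot,\cdot))$ such that $(B,\cdot,\circ,(\cdot,\cdot))$ with $a\circ b:=b\diamond a$ is a quadratic Jacobi Novikov-Poisson algebra. A Jacobi algebra is $(J,\cdot,[\cdot,\cdot])$ where $(J,\cdot)$ is a unital commutative associative algebra with identity $1_J$, $(J,[\cdot,\cdot])$ is a Lie algebra, and $[a,b\cdot c]=[a,b]\cdot c+b\cdot[a,c]+b\cdot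 c\cdot[1_J,a]$ for all $a,b,c\in J$. A Frobenius Jacobi algebra is $(J,\cdot,[\cdot,\cdot],(\cdot,\cdot)_J)$ with $(J,\cdot,[\cdot,\cdot])$ a finite-dimensional Jacobi algebra and $(\cdot,\cdot)_J$ a nondegenerate symmetric bilinear form such that $(a\cdot b,c)_J=(a,b\cdot c)_J$ and $([a,b],c)_J=(a,[b,c])_J$ for all $a,b,c\in J$. *)

theory Defs
  imports "HOL-Algebra.AbelCoset" "Jordan_Normal_Form.Missing_VectorSpace"
begin

section \<open>Bilinear maps and bilinear forms\<close>

definition bilinear_map ::
    "('k, 'r) ring_scheme \<Rightarrow> ('k, 'u, 'm) module_scheme \<Rightarrow> ('k, 'v, 'n) module_scheme \<Rightarrow>
      ('k, 'w, 'l) module_scheme \<Rightarrow> ('u \<Rightarrow> 'v \<Rightarrow> 'w) \<Rightarrow> bool" where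
  "bilinear_map K U V W f \<longleftrightarrow>
     (\<forall>u \<in> carrier U. (\<lambda>v. f u v) \<in> module_hom K V W) \<and>
     (\<forall>v \<in> carrier V. (\<lambda>u. f u v) \<in> module_hom K U W)"

definition ground_module :: "('k, 'r) ring_scheme \<Rightarrow> ('k, 'k) module" where
  "ground_module K =
     \<lparr>carrier = carrier K, mult = mult K, one = one K, zero = zero K, add = add K, smult = mult K\<rparr>"

locale nondegenerate_symmetric_form = vectorspace K V
  for K :: "('k, 'r) ring_scheme" and V :: "('k, 'v, 'n) module_scheme" +
  fixes form :: "'v \<Rightarrow> 'v \<Rightarrow> 'k"
  assumes form_bilinear: "bilinear_map K V V (ground_module K) form"
    and form_sym: "\<lbrakk>x \<in> carrier V; y \<in> carrier V\<rbrakk> \<Longrightarrow> form x y = form y x"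
    and form_nondegenerate:
      "\<lbrakk>x \<in> carrier V; \<And>y. y \<in> carrier V \<Longrightarrow> form x y = \<zero>\<^bsub>K\<^esub>\<rbrakk> \<Longrightarrow> x = \<zero>\<^bsub>V\<^esub>"


section \<open>Novikov, Novikov--Poisson and Jacobi algebras\<close>

locale novikov_algebra = vectorspace K A
  for K :: "('k, 'r) ring_scheme" and A :: "('k, 'a, 'm) module_scheme" (structure) +
  fixes circ :: "'a \<Rightarrow> 'a \<Rightarrow> 'a" (infixl "\<star>" 70)
  assumes circ_bilinear: "bilinear_map K A A A (\<star>)"
    and circ_left_symmetric:
      "\<lbrakk>a \<in> carrier A; b \<in> carrier A; c \<in> carrier A\<rbrakk> \<Longrightarrow>
        ((a \<star> b) \<star> c) \<ominus> (a \<star> (b \<star> c)) = ((b \<star> a) \<star> c) \<ominus> (b \<star> (a \<star> c))"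
    and circ_right_commute:
      "\<lbrakk>a \<in> carrier A; b \<in> carrier A; c \<in> carrier A\<rbrakk> \<Longrightarrow> (a \<star> b) \<star> c = (a \<star> c) \<star> b"

text \<open>
  The associative product and its unit are the ring product and unit of the record \<open>A\<close>; the
  locale \<^locale>\<open>algebra\<close> says that \<open>A\<close> is a unital commutative associative algebra over \<open>K\<close>.
\<close>

locale jacobi_novikov_poisson_algebra = algebra K A + novikov_algebra K A circ
  for K :: "('k, 'r) ring_scheme" and A :: "('k, 'a, 'm) module_scheme" (structure)
    and circ :: "'a \<Rightarrow> 'a \<Rightarrow> 'a" (infixl "\<star>" 70) +
  assumes mult_circ:
      "\<lbrakk>a \<in> carrier A; b \<in> carrier A; c \<in> carrier A\<rbrakk> \<Longrightarrow> (a \<otimes> b) \<star> c = a \<otimes> (b \<star> c)"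
    and circ_mult:
      "\<lbrakk>a \<in> carrier A; b \<in> carrier A; c \<in> carrier A\<rbrakk> \<Longrightarrow>
        c \<star> (a \<otimes> b) = (((c \<star> a) \<otimes> b) \<oplus> (a \<otimes> (c \<star> b))) \<ominus> ((a \<otimes> b) \<otimes> (c \<star> \<one>))"

locale quadratic_jacobi_novikov_poisson_algebra =
  jacobi_novikov_poisson_algebra K A circ + nondegenerate_symmetric_form K A form
  for K :: "('k, 'r) ring_scheme" and A :: "('k, 'a, 'm) module_scheme" (structure)
    and circ :: "'a \<Rightarrow> 'a \<Rightarrow> 'a" (infixl "\<star>" 70) and form :: "'a \<Rightarrow> 'a \<Rightarrow> 'k" +
  assumes form_mult:
      "\<lbrakk>a \<in> carrier A; b \<in> carrier A; c \<in> carrier A\<rbrakk> \<Longrightarrow> form (a \<otimes> b) c = form a (b \<otimes> c)"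
    and form_circ:
      "\<lbrakk>a \<in> carrier A; b \<in> carrier A; c \<in> carrier A\<rbrakk> \<Longrightarrow>
        form (a \<star> b) c = \<ominus>\<^bsub>K\<^esub> form b ((a \<star> c) \<oplus> (c \<star> a))"

locale quadratic_right_jacobi_novikov_poisson_algebra =
  quadratic_jacobi_novikov_poisson_algebra K B "\<lambda>a b. diamond b a" form
  for K :: "('k, 'r) ring_scheme" and B :: "('k, 'b, 'm) module_scheme"
    and diamond :: "'b \<Rightarrow> 'b \<Rightarrow> 'b" and form :: "'b \<Rightarrow> 'b \<Rightarrow> 'k"

locale lie_algebra = vectorspace K L
  for K :: "('k, 'r) ring_scheme" and L :: "('k, 'l, 'm) module_scheme" (structure) +
  fixes bracket :: "'l \<Rightarrow> 'l \<Rightarrow> 'l"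
  assumes bracket_bilinear: "bilinear_map K L L L bracket"
    and bracket_self: "x \<in> carrier L \<Longrightarrow> bracket x x = \<zero>"
    and bracket_jacobi:
      "\<lbrakk>x \<in> carrier L; y \<in> carrier L; z \<in> carrier L\<rbrakk> \<Longrightarrow>
        bracket x (bracket y z) \<oplus> bracket y (bracket z x) \<oplus> bracket z (bracket x y) = \<zero>"

locale jacobi_algebra = algebra K J + lie_algebra K J bracket
  for K :: "('k, 'r) ring_scheme" and J :: "('k, 'j, 'm) module_scheme" (structure)
    and bracket :: "'j \<Rightarrow> 'j \<Rightarrow> 'j" +
  assumes bracket_mult:
      "\<lbrakk>a \<in> carrier J; b \<in> carrier J; c \<in> carrier J\<rbrakk> \<Longrightarrow>
        bracket a (b \<otimes> c) =
          (bracket a b \<otimes> c) \<oplus> (b \<otimes> bracket a c) \<oplus> ((b \<otimes> c) \<otimes> bracket \<one> a)"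

locale frobenius_jacobi_algebra =
  jacobi_algebra K J bracket + nondegenerate_symmetric_form K J form
  for K :: "('k, 'r) ring_scheme" and J :: "('k, 'j, 'm) module_scheme" (structure)
    and bracket :: "'j \<Rightarrow> 'j \<Rightarrow> 'j" and form :: "'j \<Rightarrow> 'j \<Rightarrow> 'k" +
  assumes finite_dimensional: "fin_dim"
    and form_mult:
      "\<lbrakk>a \<in> carrier J; b \<in> carrier J; c \<in> carrier J\<rbrakk> \<Longrightarrow> form (a \<otimes> b) c = form a (b \<otimes> c)"
    and form_bracket:
      "\<lbrakk>a \<in> carrier J; b \<in> carrier J; c \<in> carrier J\<rbrakk> \<Longrightarrow>
        form (bracket a b) c = form a (bracket b c)"


section \<open>Tensor products of vector spaces\<close>

text \<open>
  The ring operations of the records built here are irrelevant; only the module structure is used,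
  until \<open>tensor_algebra\<close> installs the product and unit of the tensor product algebra.
\<close>

definition free_module :: "('k, 'r) ring_scheme \<Rightarrow> 's set \<Rightarrow> ('k, 's \<Rightarrow> 'k) module" where
  "free_module K S = (ring.func_space K S)
     \<lparr>carrier := {f \<in> carrier (ring.func_space K S). finite {s \<in> S. f s \<noteq> \<zero>\<^bsub>K\<^esub>}}\<rparr>"

definition free_gen :: "('k, 'r) ring_scheme \<Rightarrow> 's set \<Rightarrow> 's \<Rightarrow> 's \<Rightarrow> 'k" where
  "free_gen K S s = (\<lambda>t \<in> S. if t = s then \<one>\<^bsub>K\<^esub> else \<zero>\<^bsub>K\<^esub>)"

definition quotient_module :: "('k, 'v, 'm) module_scheme \<Rightarrow> 'v set \<Rightarrow> ('k, 'v set) module" where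
  "quotient_module V N =
     \<lparr>carrier = a_rcosets\<^bsub>V\<^esub> N, mult = undefined, one = undefined, zero = N, add = set_add V,
      smult = (\<lambda>c X. \<Union>x\<in>X. N +>\<^bsub>V\<^esub> (c \<odot>\<^bsub>V\<^esub> x))\<rparr>"

text \<open>The free module on the set of pairs, modulo the relations that make pairs bilinear.\<close>

definition pairs_module :: "('k, 'r) ring_scheme \<Rightarrow> ('k, 'a, 'm) module_scheme \<Rightarrow>
    ('k, 'b, 'n) module_scheme \<Rightarrow> ('k, 'a \<times> 'b \<Rightarrow> 'k) module" where
  "pairs_module K A B = free_module K (carrier A \<times> carrier B)"

definition pair_gen :: "('k, 'r) ring_scheme \<Rightarrow> ('k, 'a, 'm) module_scheme \<Rightarrow>
    ('k, 'b, 'n) module_scheme \<Rightarrow> 'a \<Rightarrow> 'b \<Rightarrow> 'a \<times> 'b \<Rightarrow> 'k" where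
  "pair_gen K A B a b = free_gen K (carrier A \<times> carrier B) (a, b)"

definition tensor_relations :: "('k, 'r) ring_scheme \<Rightarrow> ('k, 'a, 'm) module_scheme \<Rightarrow>
    ('k, 'b, 'n) module_scheme \<Rightarrow> ('a \<times> 'b \<Rightarrow> 'k) set" where
  "tensor_relations K A B =
     (let F = pairs_module K A B; g = pair_gen K A B in
        {g (a \<oplus>\<^bsub>A\<^esub> a') b \<ominus>\<^bsub>F\<^esub> (g a b \<oplus>\<^bsub>F\<^esub> g a' b) | a a' b.
           a \<in> carrier A \<and> a' \<in> carrier A \<and> b \<in> carrier B} \<union>
        {g a (b \<oplus>\<^bsub>B\<^esub> b') \<ominus>\<^bsub>F\<^esub> (g a b \<oplus>\<^bsub>F\<^esub> g a b') | a b b'.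
           a \<in> carrier A \<and> b \<in> carrier B \<and> b' \<in> carrier B} \<union>
        {g (c \<odot>\<^bsub>A\<^esub> a) b \<ominus>\<^bsub>F\<^esub> (c \<odot>\<^bsub>F\<^esub> g a b) | c a b.
           c \<in> carrier K \<and> a \<in> carrier A \<and> b \<in> carrier B} \<union>
        {g a (c \<odot>\<^bsub>B\<^esub> b) \<ominus>\<^bsub>F\<^esub> (c \<odot>\<^bsub>F\<^esub> g a b) | c a b.
           c \<in> carrier K \<and> a \<in> carrier A \<and> b \<in> carrier B})"

definition tensor_kernel :: "('k, 'r) ring_scheme \<Rightarrow> ('k, 'a, 'm) module_scheme \<Rightarrow>
    ('k, 'b, 'n) module_scheme \<Rightarrow> ('a \<times> 'b \<Rightarrow> 'k) set" where
  "tensor_kernel K A B = module.span K (pairs_module K A B) (tensor_relations K A B)"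

definition tensor_space :: "('k, 'r) ring_scheme \<Rightarrow> ('k, 'a, 'm) module_scheme \<Rightarrow>
    ('k, 'b, 'n) module_scheme \<Rightarrow> ('k, ('a \<times> 'b \<Rightarrow> 'k) set) module" where
  "tensor_space K A B = quotient_module (pairs_module K A B) (tensor_kernel K A B)"

definition pure_tensor :: "('k, 'r) ring_scheme \<Rightarrow> ('k, 'a, 'm) module_scheme \<Rightarrow>
    ('k, 'b, 'n) module_scheme \<Rightarrow> 'a \<Rightarrow> 'b \<Rightarrow> ('a \<times> 'b \<Rightarrow> 'k) set" where
  "pure_tensor K A B a b = tensor_kernel K A B +>\<^bsub>pairs_module K A B\<^esub> pair_gen K A B a b"

text \<open>
  A bilinear map on the tensor product is determined by its values on pairs of pure tensors;
  \<open>tensor_extension K A B W \<phi>\<close> is the one with values \<open>\<phi> a1 a2 b1 b2\<close> on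
  \<open>(a1 \<otimes> a2, b1 \<otimes> b2)\<close>. It exists whenever \<open>\<phi>\<close> is bilinear in \<open>(a1, a2)\<close> and in \<open>(b1, b2)\<close>:
  see the facts \<open>tensor_extension\<close> and \<open>tensor_extension_unique\<close> below, and
  \<open>tensor_algebra_mult\<close>, \<open>tensor_bracket\<close>, \<open>tensor_form\<close> for the instances used here. Off the
  carrier its values are irrelevant.
\<close>

definition tensor_extension :: "('k, 'r) ring_scheme \<Rightarrow> ('k, 'a, 'm) module_scheme \<Rightarrow>
    ('k, 'b, 'n) module_scheme \<Rightarrow> ('k, 'w, 'l) module_scheme \<Rightarrow> ('a \<Rightarrow> 'b \<Rightarrow> 'a \<Rightarrow> 'b \<Rightarrow> 'w) \<Rightarrow>
    ('a \<times> 'b \<Rightarrow> 'k) set \<Rightarrow> ('a \<times> 'b \<Rightarrow> 'k) set \<Rightarrow> 'w" where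
  "tensor_extension K A B W \<phi> =
     (SOME f. bilinear_map K (tensor_space K A B) (tensor_space K A B) W f \<and>
        (\<forall>a1 \<in> carrier A. \<forall>a2 \<in> carrier B. \<forall>b1 \<in> carrier A. \<forall>b2 \<in> carrier B.
           f (pure_tensor K A B a1 a2) (pure_tensor K A B b1 b2) = \<phi> a1 a2 b1 b2))"

definition tensor_algebra :: "('k, 'r) ring_scheme \<Rightarrow> ('k, 'a, 'm) module_scheme \<Rightarrow>
    ('k, 'b, 'n) module_scheme \<Rightarrow> ('k, ('a \<times> 'b \<Rightarrow> 'k) set) module" where
  "tensor_algebra K A B = (tensor_space K A B)
     \<lparr>mult := tensor_extension K A B (tensor_space K A B)
        (\<lambda>a1 a2 b1 b2. pure_tensor K A B (a1 \<otimes>\<^bsub>A\<^esub> b1) (a2 \<otimes>\<^bsub>B\<^esub> b2)),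
      one := pure_tensor K A B \<one>\<^bsub>A\<^esub> \<one>\<^bsub>B\<^esub>\<rparr>"

definition tensor_bracket :: "('k, 'r) ring_scheme \<Rightarrow> ('k, 'a, 'm) module_scheme \<Rightarrow>
    ('k, 'b, 'n) module_scheme \<Rightarrow> ('a \<Rightarrow> 'a \<Rightarrow> 'a) \<Rightarrow> ('b \<Rightarrow> 'b \<Rightarrow> 'b) \<Rightarrow>
    ('a \<times> 'b \<Rightarrow> 'k) set \<Rightarrow> ('a \<times> 'b \<Rightarrow> 'k) set \<Rightarrow> ('a \<times> 'b \<Rightarrow> 'k) set" where
  "tensor_bracket K A B circ diamond =
     tensor_extension K A B (tensor_space K A B)
       (\<lambda>a1 a2 b1 b2.
          pure_tensor K A B (circ a1 b1) (diamond a2 b2) \<ominus>\<^bsub>tensor_space K A B\<^esub>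
          pure_tensor K A B (circ b1 a1) (diamond b2 a2))"

definition tensor_form :: "('k, 'r) ring_scheme \<Rightarrow> ('k, 'a, 'm) module_scheme \<Rightarrow>
    ('k, 'b, 'n) module_scheme \<Rightarrow> ('a \<Rightarrow> 'a \<Rightarrow> 'k) \<Rightarrow> ('b \<Rightarrow> 'b \<Rightarrow> 'k) \<Rightarrow>
    ('a \<times> 'b \<Rightarrow> 'k) set \<Rightarrow> ('a \<times> 'b \<Rightarrow> 'k) set \<Rightarrow> 'k" where
  "tensor_form K A B formA formB =
     tensor_extension K A B (ground_module K)
       (\<lambda>a1 a2 b1 b2. formA a1 b1 \<otimes>\<^bsub>K\<^esub> formB a2 b2)"


section \<open>Existence and uniqueness of bilinear extensions\<close>

definition lincomb_closed_set where
  "lincomb_closed_set K V P \<longleftrightarrow> \<zero>\<^bsub>V\<^esub> \<in> P \<and> (\<forall>x\<in>P. \<forall>y\<in>P. x \<oplus>\<^bsub>V\<^esub> y \<in> P) \<and> (\<forall>c\<in>carrier K. \<forall>x\<in>P. c \<odot>\<^bsub>V\<^esub> x \<in> P)"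

lemma module_homI:
  assumes "\<And>x. x \<in> carrier M \<Longrightarrow> f x \<in> carrier N"
    and "\<And>x y. \<lbrakk>x \<in> carrier M; y \<in> carrier M\<rbrakk> \<Longrightarrow> f (x \<oplus>\<^bsub>M\<^esub> y) = f x \<oplus>\<^bsub>N\<^esub> f y"
    and "\<And>c x. \<lbrakk>c \<in> carrier R; x \<in> carrier M\<rbrakk> \<Longrightarrow> f (c \<odot>\<^bsub>M\<^esub> x) = c \<odot>\<^bsub>N\<^esub> f x"
  shows "f \<in> module_hom R M N"
  using assms by (auto simp: module_hom_def)

lemma module_hom_in: "\<lbrakk>f \<in> module_hom R M N; x \<in> carrier M\<rbrakk> \<Longrightarrow> f x \<in> carrier N"
  by (auto simp: module_hom_def)

lemma module_hom_minus:
  assumes "module R M" "module R N" "f \<in> module_hom R M N" "x \<in> carrier M" "y \<in> carrier M"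
  shows "f (x \<ominus>\<^bsub>M\<^esub> y) = f x \<ominus>\<^bsub>N\<^esub> f y"
proof -
  interpret mod_hom R M N f using assms by (simp add: mod_hom_def mod_hom_axioms_def)
  show ?thesis using assms by simp
qed

lemma module_hom_zero:
  assumes "module R M" "module R N" "f \<in> module_hom R M N"
  shows "f \<zero>\<^bsub>M\<^esub> = \<zero>\<^bsub>N\<^esub>"
proof -
  interpret mod_hom R M N f using assms by (simp add: mod_hom_def mod_hom_axioms_def)
  show ?thesis by simp
qed

context
  fixes K :: "('k, 'r) ring_scheme" and S :: "'s set"
  assumes cring: "cring K"
begin

interpretation cring K by (rule cring)

lemma free_module_simps:
  "carrier (free_module K S) = {f \<in> S \<rightarrow>\<^sub>E carrier K. finite {s \<in> S. f s \<noteq> \<zero>\<^bsub>K\<^esub>}}"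
  "zero (free_module K S) = (\<lambda>s\<in>S. \<zero>\<^bsub>K\<^esub>)"
  "add (free_module K S) f g = (\<lambda>s\<in>S. f s \<oplus>\<^bsub>K\<^esub> g s)"
  "smult (free_module K S) c f = (\<lambda>s\<in>S. c \<otimes>\<^bsub>K\<^esub> f s)"
  by (simp_all add: free_module_def func_space_def)

lemma free_module_is_module: "module K (free_module K S)"
proof -
  interpret V: module K "func_space S" by (rule func_space_is_module)
  have "submodule K (carrier (free_module K S)) (func_space S)"
  proof (rule submodule.intro)
    show "module K (func_space S)" by (rule func_space_is_module)
  next
    fix f g assume "f \<in> carrier (free_module K S)" "g \<in> carrier (free_module K S)"
    hence "finite ({s \<in> S. f s \<noteq> \<zero>\<^bsub>K\<^esub>} \<union> {s \<in> S. g s \<noteq> \<zero>\<^bsub>K\<^esub>})" and fg: "f \<in> S \<rightarrow>\<^sub>E carrier K" "g \<in> S \<rightarrow>\<^sub>E carrier K"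
      by (auto simp: free_module_simps)
    moreover have "{s \<in> S. f s \<oplus>\<^bsub>K\<^esub> g s \<noteq> \<zero>\<^bsub>K\<^esub>} \<subseteq> {s \<in> S. f s \<noteq> \<zero>\<^bsub>K\<^esub>} \<union> {s \<in> S. g s \<noteq> \<zero>\<^bsub>K\<^esub>}"
      by auto
    ultimately have "finite {s \<in> S. f s \<oplus>\<^bsub>K\<^esub> g s \<noteq> \<zero>\<^bsub>K\<^esub>}" by (meson finite_subset)
    hence "finite {s \<in> S. (\<lambda>s\<in>S. f s \<oplus>\<^bsub>K\<^esub> g s) s \<noteq> \<zero>\<^bsub>K\<^esub>}" by (simp cong: conj_cong)
    thus "f \<oplus>\<^bsub>func_space S\<^esub> g \<in> carrier (free_module K S)" using fg
      by (auto simp: free_module_simps func_space_def)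
  next
    fix c f assume c: "c \<in> carrier K" and f: "f \<in> carrier (free_module K S)"
    have "{s \<in> S. c \<otimes>\<^bsub>K\<^esub> f s \<noteq> \<zero>\<^bsub>K\<^esub>} \<subseteq> {s \<in> S. f s \<noteq> \<zero>\<^bsub>K\<^esub>}" using c by auto
    moreover have "finite {s \<in> S. f s \<noteq> \<zero>\<^bsub>K\<^esub>}" using f by (simp add: free_module_simps)
    ultimately have "finite {s \<in> S. c \<otimes>\<^bsub>K\<^esub> f s \<noteq> \<zero>\<^bsub>K\<^esub>}" by (rule finite_subset)
    hence "finite {s \<in> S. (\<lambda>s\<in>S. c \<otimes>\<^bsub>K\<^esub> f s) s \<noteq> \<zero>\<^bsub>K\<^esub>}" by (simp cong: conj_cong)
    thus "c \<odot>\<^bsub>func_space S\<^esub> f \<in> carrier (free_module K S)" using c f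
      by (auto simp: free_module_simps func_space_def)
  next
    show "carrier (free_module K S) \<subseteq> carrier (func_space S)"
      by (simp add: free_module_def subset_iff)
    have "{s \<in> S. (\<lambda>s\<in>S. \<zero>\<^bsub>K\<^esub>) s \<noteq> \<zero>\<^bsub>K\<^esub>} = {}" by auto
    thus "\<zero>\<^bsub>func_space S\<^esub> \<in> carrier (free_module K S)"
      unfolding free_module_simps(1) by (simp add: func_space_def)
  qed
  from V.submodule_is_module[OF this] show ?thesis
    by (simp add: free_module_def)
qed

interpretation F: module K "free_module K S" by (rule free_module_is_module)

lemma free_gen_closed: "s \<in> S \<Longrightarrow> free_gen K S s \<in> carrier (free_module K S)"
proof -
  assume s: "s \<in> S"
  have "{t \<in> S. free_gen K S s t \<noteq> \<zero>\<^bsub>K\<^esub>} \<subseteq> {s}" by (auto simp: free_gen_def)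
  hence "finite {t \<in> S. free_gen K S s t \<noteq> \<zero>\<^bsub>K\<^esub>}" using finite_subset by blast
  thus ?thesis by (simp add: free_module_simps free_gen_def)
qed

lemma free_module_induct:
  assumes P: "lincomb_closed_set K (free_module K S) P"
    and gen: "\<And>s. s \<in> S \<Longrightarrow> free_gen K S s \<in> P"
    and f: "f \<in> carrier (free_module K S)"
  shows "f \<in> P"
proof -
  have "\<forall>f\<in>carrier (free_module K S). {s \<in> S. f s \<noteq> \<zero>\<^bsub>K\<^esub>} \<subseteq> X \<longrightarrow> f \<in> P" if "finite X" for X
    using that
  proof (induction X)
    case empty
    have "f = zero (free_module K S)"
      if "f \<in> carrier (free_module K S)" "{s \<in> S. f s \<noteq> \<zero>\<^bsub>K\<^esub>} \<subseteq> {}" for f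
      using that unfolding free_module_simps by (intro ext) (auto simp: PiE_def extensional_def)
    thus ?case using P by (auto simp: lincomb_closed_set_def)
  next
    case (insert x X)
    show ?case
    proof (intro ballI impI)
      fix f assume f: "f \<in> carrier (free_module K S)" and sub: "{s \<in> S. f s \<noteq> \<zero>\<^bsub>K\<^esub>} \<subseteq> insert x X"
      show "f \<in> P"
      proof (cases "x \<in> S")
        case False
        hence "{s \<in> S. f s \<noteq> \<zero>\<^bsub>K\<^esub>} \<subseteq> X" using sub by auto
        thus ?thesis using insert.IH f by blast
      next
        case True
        define g where "g = (\<lambda>s\<in>S. if s = x then \<zero>\<^bsub>K\<^esub> else f s)"
        have "finite {s \<in> S. f s \<noteq> \<zero>\<^bsub>K\<^esub>}" using f by (simp add: free_module_simps)
        moreover have "{s \<in> S. g s \<noteq> \<zero>\<^bsub>K\<^esub>} \<subseteq> {s \<in> S. f s \<noteq> \<zero>\<^bsub>K\<^esub>}" by (auto simp: g_def)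
        ultimately have "finite {s \<in> S. g s \<noteq> \<zero>\<^bsub>K\<^esub>}" by (meson finite_subset)
        moreover have "g \<in> S \<rightarrow>\<^sub>E carrier K" using f by (auto simp: g_def free_module_simps)
        ultimately have "g \<in> carrier (free_module K S)" by (simp add: free_module_simps)
        moreover have "{s \<in> S. g s \<noteq> \<zero>\<^bsub>K\<^esub>} \<subseteq> X" using sub by (auto simp: g_def)
        ultimately have g: "g \<in> P" using insert.IH by blast
        have fx: "f x \<in> carrier K" using f True by (auto simp: free_module_simps)
        have "f = (f x \<odot>\<^bsub>free_module K S\<^esub> free_gen K S x) \<oplus>\<^bsub>free_module K S\<^esub> g"
          using f True fx by (intro ext) (auto simp: free_module_simps free_gen_def g_def PiE_def extensional_def Pi_def)
        thus ?thesis using P g fx gen[OF True] by (metis lincomb_closed_set_def)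
      qed
    qed
  qed
  thus ?thesis using f by (auto simp: free_module_simps)
qed

lemma free_module_lift:
  assumes W: "module K W" and \<phi>: "\<And>s. s \<in> S \<Longrightarrow> \<phi> s \<in> carrier W"
  shows "\<exists>h \<in> module_hom K (free_module K S) W. \<forall>s\<in>S. h (free_gen K S s) = \<phi> s"
proof -
  interpret W: module K W by (rule W)
  define h where "h f = (\<Oplus>\<^bsub>W\<^esub> s \<in> {s \<in> S. f s \<noteq> \<zero>\<^bsub>K\<^esub>}. f s \<odot>\<^bsub>W\<^esub> \<phi> s)" for f
  have ext: "h f = (\<Oplus>\<^bsub>W\<^esub> s \<in> X. f s \<odot>\<^bsub>W\<^esub> \<phi> s)"
    if "finite X" "X \<subseteq> S" "f \<in> S \<rightarrow> carrier K" "{s \<in> S. f s \<noteq> \<zero>\<^bsub>K\<^esub>} \<subseteq> X" for f X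
    unfolding h_def
    by (rule W.add.finprod_mono_neutral_cong_left) (use that \<phi> in \<open>auto simp: Pi_def\<close>)
  show ?thesis
  proof (rule bexI[of _ h], intro ballI)
    fix s assume s: "s \<in> S"
    have "h (free_gen K S s) = (\<Oplus>\<^bsub>W\<^esub> t \<in> {s}. free_gen K S s t \<odot>\<^bsub>W\<^esub> \<phi> t)"
      by (rule ext) (use s in \<open>auto simp: free_gen_def\<close>)
    thus "h (free_gen K S s) = \<phi> s" using s \<phi> by (simp add: free_gen_def)
  next
    show "h \<in> module_hom K (free_module K S) W"
    proof (rule module_homI)
      fix f assume "f \<in> carrier (free_module K S)"
      thus "h f \<in> carrier W" unfolding h_def
        by (intro W.finsum_closed) (use \<phi> in \<open>auto simp: free_module_simps\<close>)
    next
      fix f g assume f: "f \<in> carrier (free_module K S)" and g: "g \<in> carrier (free_module K S)"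
      let ?X = "{s \<in> S. f s \<noteq> \<zero>\<^bsub>K\<^esub>} \<union> {s \<in> S. g s \<noteq> \<zero>\<^bsub>K\<^esub>}"
      have fin: "finite ?X" using f g by (simp add: free_module_simps)
      have fg: "f \<in> S \<rightarrow> carrier K" "g \<in> S \<rightarrow> carrier K" using f g by (auto simp: free_module_simps)
      have "h (f \<oplus>\<^bsub>free_module K S\<^esub> g) = (\<Oplus>\<^bsub>W\<^esub> s \<in> ?X. (f \<oplus>\<^bsub>free_module K S\<^esub> g) s \<odot>\<^bsub>W\<^esub> \<phi> s)"
        by (rule ext) (use fin fg in \<open>auto simp: free_module_simps Pi_def\<close>)
      also have "\<dots> = (\<Oplus>\<^bsub>W\<^esub> s \<in> ?X. f s \<odot>\<^bsub>W\<^esub> \<phi> s \<oplus>\<^bsub>W\<^esub> g s \<odot>\<^bsub>W\<^esub> \<phi> s)"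
        by (rule W.add.finprod_cong') (use fg \<phi> in \<open>auto simp: free_module_simps W.smult_l_distr Pi_def\<close>)
      also have "\<dots> = (\<Oplus>\<^bsub>W\<^esub> s \<in> ?X. f s \<odot>\<^bsub>W\<^esub> \<phi> s) \<oplus>\<^bsub>W\<^esub> (\<Oplus>\<^bsub>W\<^esub> s \<in> ?X. g s \<odot>\<^bsub>W\<^esub> \<phi> s)"
        by (rule W.finsum_addf) (use fg \<phi> in \<open>auto simp: Pi_def\<close>)
      also have "(\<Oplus>\<^bsub>W\<^esub> s \<in> ?X. f s \<odot>\<^bsub>W\<^esub> \<phi> s) = h f" by (rule ext[symmetric]) (use fin fg in auto)
      also have "(\<Oplus>\<^bsub>W\<^esub> s \<in> ?X. g s \<odot>\<^bsub>W\<^esub> \<phi> s) = h g" by (rule ext[symmetric]) (use fin fg in auto)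
      finally show "h (f \<oplus>\<^bsub>free_module K S\<^esub> g) = h f \<oplus>\<^bsub>W\<^esub> h g" .
    next
      fix c f assume c: "c \<in> carrier K" and f: "f \<in> carrier (free_module K S)"
      let ?X = "{s \<in> S. f s \<noteq> \<zero>\<^bsub>K\<^esub>}"
      have fin: "finite ?X" and f': "f \<in> S \<rightarrow> carrier K" using f by (auto simp: free_module_simps)
      have "h (c \<odot>\<^bsub>free_module K S\<^esub> f) = (\<Oplus>\<^bsub>W\<^esub> s \<in> ?X. (c \<odot>\<^bsub>free_module K S\<^esub> f) s \<odot>\<^bsub>W\<^esub> \<phi> s)"
        by (rule ext) (use fin f' c in \<open>auto simp: free_module_simps Pi_def\<close>)
      also have "\<dots> = (\<Oplus>\<^bsub>W\<^esub> s \<in> ?X. c \<odot>\<^bsub>W\<^esub> (f s \<odot>\<^bsub>W\<^esub> \<phi> s))"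
        by (rule W.add.finprod_cong') (use f' c \<phi> in \<open>auto simp: free_module_simps W.smult_assoc1 Pi_def\<close>)
      also have "\<dots> = c \<odot>\<^bsub>W\<^esub> h f" unfolding h_def
        by (rule W.finsum_smult_ldistr[symmetric]) (use fin f' c \<phi> in \<open>auto simp: Pi_def\<close>)
      finally show "h (c \<odot>\<^bsub>free_module K S\<^esub> f) = c \<odot>\<^bsub>W\<^esub> h f" .
    qed
  qed
qed

end

context
  fixes K :: "('k, 'r) ring_scheme" and V :: "('k, 'v, 'm) module_scheme" and N :: "'v set"
  assumes V: "module K V" and N: "submodule K N V"
begin

interpretation V: module K V by (rule V)
interpretation N: submodule K N V by (rule N)

lemma abelian_subgroup_submodule: "abelian_subgroup N V"
proof (rule abelian_subgroupI3)
  show "additive_subgroup N V"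
  proof (unfold_locales)
    fix x assume x: "x \<in> N"
    hence "(\<ominus>\<^bsub>K\<^esub> \<one>\<^bsub>K\<^esub>) \<odot>\<^bsub>V\<^esub> x \<in> N" by simp
    moreover have "x \<in> carrier V" using x N.subset by auto
    ultimately show "inv\<^bsub>add_monoid V\<^esub> x \<in> N" by (simp add: V.smult_minus_1 flip: a_inv_def)
  next
    show "N \<subseteq> carrier (add_monoid V)" using N.subset by simp
    show "\<one>\<^bsub>add_monoid V\<^esub> \<in> N" by simp
    show "x \<otimes>\<^bsub>add_monoid V\<^esub> y \<in> N" if "x \<in> N" "y \<in> N" for x y using that by simp
  qed
qed (rule V.abelian_group_axioms)

interpretation Q: abelian_subgroup N V by (rule abelian_subgroup_submodule)

lemma quotient_carrierE:
  assumes "X \<in> carrier (quotient_module V N)"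
  obtains x where "x \<in> carrier V" "X = N +>\<^bsub>V\<^esub> x"
  using assms unfolding quotient_module_def A_RCOSETS_def' by auto

lemma coset_eq_iff:
  "\<lbrakk>x \<in> carrier V; y \<in> carrier V\<rbrakk> \<Longrightarrow> N +>\<^bsub>V\<^esub> x = N +>\<^bsub>V\<^esub> y \<longleftrightarrow> x \<ominus>\<^bsub>V\<^esub> y \<in> N"
  unfolding a_minus_def
  using Q.a_rcos_module[of y x] Q.a_repr_independence'[of x y] Q.a_rcos_self[of x] by blast

lemma quotient_simps:
  "x \<in> carrier V \<Longrightarrow> N +>\<^bsub>V\<^esub> x \<in> carrier (quotient_module V N)"
  "\<lbrakk>x \<in> carrier V; y \<in> carrier V\<rbrakk> \<Longrightarrow>
    (N +>\<^bsub>V\<^esub> x) \<oplus>\<^bsub>quotient_module V N\<^esub> (N +>\<^bsub>V\<^esub> y) = N +>\<^bsub>V\<^esub> (x \<oplus>\<^bsub>V\<^esub> y)"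
  "\<zero>\<^bsub>quotient_module V N\<^esub> = N +>\<^bsub>V\<^esub> \<zero>\<^bsub>V\<^esub>"
  "\<lbrakk>c \<in> carrier K; x \<in> carrier V\<rbrakk> \<Longrightarrow> c \<odot>\<^bsub>quotient_module V N\<^esub> (N +>\<^bsub>V\<^esub> x) = N +>\<^bsub>V\<^esub> (c \<odot>\<^bsub>V\<^esub> x)"
proof -
  show "N +>\<^bsub>V\<^esub> x \<in> carrier (quotient_module V N)" if "x \<in> carrier V"
    using that by (auto simp: quotient_module_def A_RCOSETS_def')
  show "(N +>\<^bsub>V\<^esub> x) \<oplus>\<^bsub>quotient_module V N\<^esub> (N +>\<^bsub>V\<^esub> y) = N +>\<^bsub>V\<^esub> (x \<oplus>\<^bsub>V\<^esub> y)"
    if "x \<in> carrier V" "y \<in> carrier V"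
    using that by (simp add: quotient_module_def Q.a_rcos_sum)
  show "\<zero>\<^bsub>quotient_module V N\<^esub> = N +>\<^bsub>V\<^esub> \<zero>\<^bsub>V\<^esub>"
    using N.subset by (simp add: quotient_module_def)
  show "c \<odot>\<^bsub>quotient_module V N\<^esub> (N +>\<^bsub>V\<^esub> x) = N +>\<^bsub>V\<^esub> (c \<odot>\<^bsub>V\<^esub> x)"
    if c: "c \<in> carrier K" and x: "x \<in> carrier V"
  proof -
    have "N +>\<^bsub>V\<^esub> (c \<odot>\<^bsub>V\<^esub> y) = N +>\<^bsub>V\<^esub> (c \<odot>\<^bsub>V\<^esub> x)" if y: "y \<in> N +>\<^bsub>V\<^esub> x" for y
    proof -
      obtain n where n: "n \<in> N" "y = n \<oplus>\<^bsub>V\<^esub> x" using y by (auto simp: a_r_coset_def')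
      have nV: "n \<in> carrier V" using n N.subset by auto
      have "c \<odot>\<^bsub>V\<^esub> y = c \<odot>\<^bsub>V\<^esub> n \<oplus>\<^bsub>V\<^esub> c \<odot>\<^bsub>V\<^esub> x" using c x n nV by (simp add: V.smult_r_distr)
      hence "c \<odot>\<^bsub>V\<^esub> y \<in> N +>\<^bsub>V\<^esub> (c \<odot>\<^bsub>V\<^esub> x)" using c n by (auto simp: a_r_coset_def')
      thus ?thesis using Q.a_repr_independence'[of "c \<odot>\<^bsub>V\<^esub> y" "c \<odot>\<^bsub>V\<^esub> x"] c x by auto
    qed
    moreover have "x \<in> N +>\<^bsub>V\<^esub> x" using x by (rule Q.a_rcos_self)
    ultimately have "(\<Union>y\<in>N +>\<^bsub>V\<^esub> x. N +>\<^bsub>V\<^esub> (c \<odot>\<^bsub>V\<^esub> y)) = N +>\<^bsub>V\<^esub> (c \<odot>\<^bsub>V\<^esub> x)"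
      by blast
    thus ?thesis by (simp add: quotient_module_def)
  qed
qed

lemma quotient_module_is_module: "module K (quotient_module V N)"
proof (rule module_criteria)
  note q = quotient_simps
  let ?Q = "quotient_module V N"
  show "cring K" by (rule V.is_cring)
  show "\<zero>\<^bsub>?Q\<^esub> \<in> carrier ?Q" by (simp add: q)
  show "\<forall>v w. v \<in> carrier ?Q \<and> w \<in> carrier ?Q \<longrightarrow> v \<oplus>\<^bsub>?Q\<^esub> w \<in> carrier ?Q"
    by (auto elim!: quotient_carrierE simp: q)
  show "\<forall>v\<in>carrier ?Q. \<exists>w\<in>carrier ?Q. v \<oplus>\<^bsub>?Q\<^esub> w = \<zero>\<^bsub>?Q\<^esub>"
  proof
    fix v assume "v \<in> carrier ?Q"
    then obtain x where x: "x \<in> carrier V" "v = N +>\<^bsub>V\<^esub> x" by (rule quotient_carrierE)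
    thus "\<exists>w\<in>carrier ?Q. v \<oplus>\<^bsub>?Q\<^esub> w = \<zero>\<^bsub>?Q\<^esub>"
      by (intro bexI[of _ "N +>\<^bsub>V\<^esub> (\<ominus>\<^bsub>V\<^esub> x)"]) (simp_all add: q V.r_neg)
  qed
next
  let ?Q = "quotient_module V N"
  show "\<forall>v w. v \<in> carrier ?Q \<and> w \<in> carrier ?Q \<longrightarrow> v \<oplus>\<^bsub>?Q\<^esub> w = w \<oplus>\<^bsub>?Q\<^esub> v"
    by (auto elim!: quotient_carrierE simp: quotient_simps V.a_comm)
  show "\<forall>v w x. v \<in> carrier ?Q \<and> w \<in> carrier ?Q \<and> x \<in> carrier ?Q \<longrightarrow>
      v \<oplus>\<^bsub>?Q\<^esub> w \<oplus>\<^bsub>?Q\<^esub> x = v \<oplus>\<^bsub>?Q\<^esub> (w \<oplus>\<^bsub>?Q\<^esub> x)"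
    by (auto elim!: quotient_carrierE simp: quotient_simps V.a_assoc)
  show "\<forall>c v. c \<in> carrier K \<and> v \<in> carrier ?Q \<longrightarrow> c \<odot>\<^bsub>?Q\<^esub> v \<in> carrier ?Q"
    by (auto elim!: quotient_carrierE simp: quotient_simps)
  show "\<forall>v\<in>carrier ?Q. v \<oplus>\<^bsub>?Q\<^esub> \<zero>\<^bsub>?Q\<^esub> = v"
    by (auto elim!: quotient_carrierE simp: quotient_simps simp del: V.a_coset_add_zero)
  show "\<forall>v\<in>carrier ?Q. \<one>\<^bsub>K\<^esub> \<odot>\<^bsub>?Q\<^esub> v = v"
    by (auto elim!: quotient_carrierE simp: quotient_simps)
  show "\<forall>a b v. a \<in> carrier K \<and> b \<in> carrier K \<and> v \<in> carrier ?Q \<longrightarrow>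
      (a \<otimes>\<^bsub>K\<^esub> b) \<odot>\<^bsub>?Q\<^esub> v = a \<odot>\<^bsub>?Q\<^esub> (b \<odot>\<^bsub>?Q\<^esub> v)"
    by (auto elim!: quotient_carrierE simp: quotient_simps V.smult_assoc1)
  show "\<forall>a b v. a \<in> carrier K \<and> b \<in> carrier K \<and> v \<in> carrier ?Q \<longrightarrow>
      (a \<oplus>\<^bsub>K\<^esub> b) \<odot>\<^bsub>?Q\<^esub> v = a \<odot>\<^bsub>?Q\<^esub> v \<oplus>\<^bsub>?Q\<^esub> b \<odot>\<^bsub>?Q\<^esub> v"
    by (auto elim!: quotient_carrierE simp: quotient_simps V.smult_l_distr)
  show "\<forall>a v w. a \<in> carrier K \<and> v \<in> carrier ?Q \<and> w \<in> carrier ?Q \<longrightarrow>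
      a \<odot>\<^bsub>?Q\<^esub> (v \<oplus>\<^bsub>?Q\<^esub> w) = a \<odot>\<^bsub>?Q\<^esub> v \<oplus>\<^bsub>?Q\<^esub> a \<odot>\<^bsub>?Q\<^esub> w"
    by (auto elim!: quotient_carrierE simp: quotient_simps V.smult_r_distr)
qed

lemma quotient_lift:
  assumes W: "module K W" and h: "h \<in> module_hom K V W" and hN: "\<And>x. x \<in> N \<Longrightarrow> h x = \<zero>\<^bsub>W\<^esub>"
  shows "\<exists>h' \<in> module_hom K (quotient_module V N) W. \<forall>x\<in>carrier V. h' (N +>\<^bsub>V\<^esub> x) = h x"
proof -
  interpret W: module K W by (rule W)
  define h' where "h' X = h (SOME x. x \<in> carrier V \<and> X = N +>\<^bsub>V\<^esub> x)" for X
  have h': "h' (N +>\<^bsub>V\<^esub> x) = h x" if x: "x \<in> carrier V" for x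
  proof -
    define y where "y = (SOME y. y \<in> carrier V \<and> N +>\<^bsub>V\<^esub> x = N +>\<^bsub>V\<^esub> y)"
    have y: "y \<in> carrier V" "N +>\<^bsub>V\<^esub> x = N +>\<^bsub>V\<^esub> y"
      using someI[of "\<lambda>y. y \<in> carrier V \<and> N +>\<^bsub>V\<^esub> x = N +>\<^bsub>V\<^esub> y" x] x by (auto simp: y_def)
    hence "x \<ominus>\<^bsub>V\<^esub> y \<in> N" using x coset_eq_iff by blast
    hence "h x \<ominus>\<^bsub>W\<^esub> h y = \<zero>\<^bsub>W\<^esub>" using hN module_hom_minus[OF V W h x y(1)] by metis
    hence "h x = h y" using x y h by (simp add: module_hom_in)
    thus ?thesis by (simp add: h'_def y_def)
  qed
  have "h' \<in> module_hom K (quotient_module V N) W"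
  proof (rule module_homI)
    fix X assume "X \<in> carrier (quotient_module V N)"
    then obtain x where "x \<in> carrier V" "X = N +>\<^bsub>V\<^esub> x" by (rule quotient_carrierE)
    thus "h' X \<in> carrier W" using module_hom_in[OF h] by (simp add: h')
  next
    fix X Y assume "X \<in> carrier (quotient_module V N)" "Y \<in> carrier (quotient_module V N)"
    then obtain x y where "x \<in> carrier V" "X = N +>\<^bsub>V\<^esub> x" "y \<in> carrier V" "Y = N +>\<^bsub>V\<^esub> y"
      by (meson quotient_carrierE)
    thus "h' (X \<oplus>\<^bsub>quotient_module V N\<^esub> Y) = h' X \<oplus>\<^bsub>W\<^esub> h' Y"
      using module_hom_add[OF h] by (simp add: quotient_simps h')
  next
    fix c X assume c: "c \<in> carrier K" and "X \<in> carrier (quotient_module V N)"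
    then obtain x where "x \<in> carrier V" "X = N +>\<^bsub>V\<^esub> x" by (metis quotient_carrierE)
    thus "h' (c \<odot>\<^bsub>quotient_module V N\<^esub> X) = c \<odot>\<^bsub>W\<^esub> h' X"
      using module_hom_smult[OF h c] c by (simp add: quotient_simps h')
  qed
  thus ?thesis using h' by blast
qed

end

context
  fixes K :: "('k, 'r) ring_scheme"
    and A :: "('k, 'a, 'm) module_scheme" and B :: "('k, 'b, 'n) module_scheme"
  assumes A: "module K A" and B: "module K B"
begin

interpretation A: module K A by (rule A)
interpretation B: module K B by (rule B)

private abbreviation (input) "F \<equiv> pairs_module K A B"
private abbreviation (input) "T \<equiv> tensor_space K A B"
private abbreviation (input) "N \<equiv> tensor_kernel K A B"
private abbreviation (input) "g \<equiv> pair_gen K A B"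
private abbreviation (input) tens (infixl "\<otimes>\<^sub>T" 75) where "a \<otimes>\<^sub>T b \<equiv> pure_tensor K A B a b"

lemma pairs_module_is_module: "module K F"
  unfolding pairs_module_def by (rule free_module_is_module) (rule A.is_cring)

interpretation F: module K "pairs_module K A B" by (rule pairs_module_is_module)

lemma pair_gen_closed: "\<lbrakk>a \<in> carrier A; b \<in> carrier B\<rbrakk> \<Longrightarrow> g a b \<in> carrier F"
  unfolding pairs_module_def pair_gen_def by (rule free_gen_closed[OF A.is_cring]) simp

lemma tensor_relations_subset: "tensor_relations K A B \<subseteq> carrier F"
  unfolding tensor_relations_def Let_def
  by (intro Un_least subsetI; elim CollectE exE conjE;
      simp only: pair_gen_closed A.a_closed B.a_closed F.a_closed F.minus_closed A.smult_closed
        B.smult_closed F.smult_closed)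

lemma tensor_kernel_submodule: "submodule K N F"
  unfolding tensor_kernel_def by (rule F.span_is_submodule[OF tensor_relations_subset])

lemma tensor_relations_kernel: "x \<in> tensor_relations K A B \<Longrightarrow> x \<in> N"
  unfolding tensor_kernel_def using F.in_own_span[OF tensor_relations_subset] by blast

lemma tensor_space_is_module: "module K T"
  unfolding tensor_space_def
  by (rule quotient_module_is_module[OF pairs_module_is_module tensor_kernel_submodule])

interpretation T: module K "tensor_space K A B" by (rule tensor_space_is_module)

lemmas tq = quotient_simps[OF pairs_module_is_module tensor_kernel_submodule, folded tensor_space_def]
lemmas teq = coset_eq_iff[OF pairs_module_is_module tensor_kernel_submodule]

lemma pure_tensor_closed: "\<lbrakk>a \<in> carrier A; b \<in> carrier B\<rbrakk> \<Longrightarrow> a \<otimes>\<^sub>T b \<in> carrier T"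
  unfolding pure_tensor_def by (rule tq(1)) (rule pair_gen_closed)

lemma pure_tensor_add_left:
  assumes "a \<in> carrier A" "a' \<in> carrier A" "b \<in> carrier B"
  shows "(a \<oplus>\<^bsub>A\<^esub> a') \<otimes>\<^sub>T b = (a \<otimes>\<^sub>T b) \<oplus>\<^bsub>T\<^esub> (a' \<otimes>\<^sub>T b)"
proof -
  have "g (a \<oplus>\<^bsub>A\<^esub> a') b \<ominus>\<^bsub>F\<^esub> (g a b \<oplus>\<^bsub>F\<^esub> g a' b) \<in> tensor_relations K A B"
    unfolding tensor_relations_def Let_def using assms by blast
  from tensor_relations_kernel[OF this] show ?thesis
    using assms by (simp add: pure_tensor_def tq teq pair_gen_closed)
qed

lemma pure_tensor_add_right:
  assumes "a \<in> carrier A" "b \<in> carrier B" "b' \<in> carrier B"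
  shows "a \<otimes>\<^sub>T (b \<oplus>\<^bsub>B\<^esub> b') = (a \<otimes>\<^sub>T b) \<oplus>\<^bsub>T\<^esub> (a \<otimes>\<^sub>T b')"
proof -
  have "g a (b \<oplus>\<^bsub>B\<^esub> b') \<ominus>\<^bsub>F\<^esub> (g a b \<oplus>\<^bsub>F\<^esub> g a b') \<in> tensor_relations K A B"
    unfolding tensor_relations_def Let_def using assms by blast
  from tensor_relations_kernel[OF this] show ?thesis
    using assms by (simp add: pure_tensor_def tq teq pair_gen_closed)
qed

lemma pure_tensor_smult_left:
  assumes "c \<in> carrier K" "a \<in> carrier A" "b \<in> carrier B"
  shows "(c \<odot>\<^bsub>A\<^esub> a) \<otimes>\<^sub>T b = c \<odot>\<^bsub>T\<^esub> (a \<otimes>\<^sub>T b)"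
proof -
  have "g (c \<odot>\<^bsub>A\<^esub> a) b \<ominus>\<^bsub>F\<^esub> (c \<odot>\<^bsub>F\<^esub> g a b) \<in> tensor_relations K A B"
    unfolding tensor_relations_def Let_def using assms by blast
  from tensor_relations_kernel[OF this] show ?thesis
    using assms by (simp add: pure_tensor_def tq teq pair_gen_closed)
qed

lemma pure_tensor_smult_right:
  assumes "c \<in> carrier K" "a \<in> carrier A" "b \<in> carrier B"
  shows "a \<otimes>\<^sub>T (c \<odot>\<^bsub>B\<^esub> b) = c \<odot>\<^bsub>T\<^esub> (a \<otimes>\<^sub>T b)"
proof -
  have "g a (c \<odot>\<^bsub>B\<^esub> b) \<ominus>\<^bsub>F\<^esub> (c \<odot>\<^bsub>F\<^esub> g a b) \<in> tensor_relations K A B"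
    unfolding tensor_relations_def Let_def using assms by blast
  from tensor_relations_kernel[OF this] show ?thesis
    using assms by (simp add: pure_tensor_def tq teq pair_gen_closed)
qed

lemma pure_tensor_bilinear: "bilinear_map K A B T (\<lambda>a b. a \<otimes>\<^sub>T b)"
  by (auto simp: bilinear_map_def pure_tensor_closed pure_tensor_add_left pure_tensor_add_right
      pure_tensor_smult_left pure_tensor_smult_right intro!: module_homI)

lemma tensor_space_induct:
  assumes P: "lincomb_closed_set K T P"
    and pure: "\<And>a b. \<lbrakk>a \<in> carrier A; b \<in> carrier B\<rbrakk> \<Longrightarrow> a \<otimes>\<^sub>T b \<in> P"
    and x: "x \<in> carrier T"
  shows "x \<in> P"
proof -
  obtain f where f: "f \<in> carrier F" and xf: "x = N +>\<^bsub>F\<^esub> f"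
    using quotient_carrierE[OF pairs_module_is_module tensor_kernel_submodule] x
    unfolding tensor_space_def by metis
  have "f \<in> {f \<in> carrier F. N +>\<^bsub>F\<^esub> f \<in> P}"
  proof (rule free_module_induct[OF A.is_cring, of "carrier A \<times> carrier B"])
    show "f \<in> carrier (free_module K (carrier A \<times> carrier B))" using f by (simp add: pairs_module_def)
    show "lincomb_closed_set K (free_module K (carrier A \<times> carrier B)) {f \<in> carrier F. N +>\<^bsub>F\<^esub> f \<in> P}"
      unfolding pairs_module_def[symmetric] lincomb_closed_set_def
    proof (intro conjI ballI)
      show "\<zero>\<^bsub>F\<^esub> \<in> {f \<in> carrier F. N +>\<^bsub>F\<^esub> f \<in> P}"
        using P tq(3) by (simp add: lincomb_closed_set_def)
    next
      fix y z assume "y \<in> {f \<in> carrier F. N +>\<^bsub>F\<^esub> f \<in> P}" "z \<in> {f \<in> carrier F. N +>\<^bsub>F\<^esub> f \<in> P}"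
      thus "y \<oplus>\<^bsub>F\<^esub> z \<in> {f \<in> carrier F. N +>\<^bsub>F\<^esub> f \<in> P}"
        using P tq(2)[of y z, symmetric] unfolding lincomb_closed_set_def by simp
    next
      fix c y assume "c \<in> carrier K" "y \<in> {f \<in> carrier F. N +>\<^bsub>F\<^esub> f \<in> P}"
      thus "c \<odot>\<^bsub>F\<^esub> y \<in> {f \<in> carrier F. N +>\<^bsub>F\<^esub> f \<in> P}"
        using P tq(4)[of c y, symmetric] unfolding lincomb_closed_set_def by simp
    qed
    show "free_gen K (carrier A \<times> carrier B) s \<in> {f \<in> carrier F. N +>\<^bsub>F\<^esub> f \<in> P}"
      if "s \<in> carrier A \<times> carrier B" for s
      using that pure[of "fst s" "snd s"] pair_gen_closed[of "fst s" "snd s"]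
      by (auto simp: pair_gen_def pure_tensor_def)
  qed
  thus ?thesis using xf by simp
qed

lemma tensor_hom_eqI:
  assumes W: "module K W" and h: "h \<in> module_hom K T W" and h': "h' \<in> module_hom K T W"
    and eq: "\<And>a b. \<lbrakk>a \<in> carrier A; b \<in> carrier B\<rbrakk> \<Longrightarrow> h (a \<otimes>\<^sub>T b) = h' (a \<otimes>\<^sub>T b)"
    and x: "x \<in> carrier T"
  shows "h x = h' x"
proof -
  have "x \<in> {x \<in> carrier T. h x = h' x}"
  proof (rule tensor_space_induct[OF _ _ x])
    show "lincomb_closed_set K T {x \<in> carrier T. h x = h' x}"
      using module_hom_zero[OF tensor_space_is_module W h] module_hom_zero[OF tensor_space_is_module W h']
        module_hom_add[OF h] module_hom_add[OF h'] module_hom_smult[OF h] module_hom_smult[OF h']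
      by (auto simp: lincomb_closed_set_def)
  qed (auto simp: eq pure_tensor_closed)
  thus ?thesis by simp
qed

lemma tensor_lift:
  assumes W: "module K W" and \<phi>: "bilinear_map K A B W \<phi>"
  shows "\<exists>h \<in> module_hom K T W. \<forall>a\<in>carrier A. \<forall>b\<in>carrier B. h (a \<otimes>\<^sub>T b) = \<phi> a b"
proof -
  interpret W: module K W by (rule W)
  have \<phi>1: "(\<lambda>b. \<phi> a b) \<in> module_hom K B W" if "a \<in> carrier A" for a
    using \<phi> that by (simp add: bilinear_map_def)
  have \<phi>2: "(\<lambda>a. \<phi> a b) \<in> module_hom K A W" if "b \<in> carrier B" for b
    using \<phi> that by (simp add: bilinear_map_def)
  have closed: "\<phi> a b \<in> carrier W" if "a \<in> carrier A" "b \<in> carrier B" for a b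
    using module_hom_in[OF \<phi>1[OF that(1)] that(2)] .
  obtain h where h: "h \<in> module_hom K F W"
    and hg: "\<And>a b. \<lbrakk>a \<in> carrier A; b \<in> carrier B\<rbrakk> \<Longrightarrow> h (g a b) = \<phi> a b"
    using free_module_lift[OF A.is_cring W, of "carrier A \<times> carrier B" "\<lambda>(a, b). \<phi> a b"] closed
    unfolding pairs_module_def pair_gen_def by fastforce
  interpret h: mod_hom K "pairs_module K A B" W h
    using h W pairs_module_is_module by (simp add: mod_hom_def mod_hom_axioms_def)
  have "tensor_relations K A B \<subseteq> h.ker"
    using module_hom_add[OF \<phi>1] module_hom_add[OF \<phi>2] module_hom_smult[OF \<phi>1] module_hom_smult[OF \<phi>2]
    by (auto simp: tensor_relations_def Let_def h.ker_def hg closed pair_gen_closed)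
  hence "N \<subseteq> h.ker" unfolding tensor_kernel_def
    using F.span_is_subset[OF _ h.ker_is_submodule] by blast
  hence "\<And>x. x \<in> N \<Longrightarrow> h x = \<zero>\<^bsub>W\<^esub>" by (auto simp: h.ker_def)
  from quotient_lift[OF pairs_module_is_module tensor_kernel_submodule W h this]
  obtain h' where "h' \<in> module_hom K T W" "\<forall>x\<in>carrier F. h' (N +>\<^bsub>F\<^esub> x) = h x"
    unfolding tensor_space_def by blast
  thus ?thesis using hg by (intro bexI[of _ h']) (auto simp: pure_tensor_def pair_gen_closed)
qed

lemma tensor_extension_exists:
  assumes W: "module K W"
    and \<phi>1: "\<And>b1 b2. \<lbrakk>b1 \<in> carrier A; b2 \<in> carrier B\<rbrakk> \<Longrightarrow> bilinear_map K A B W (\<lambda>a1 a2. \<phi> a1 a2 b1 b2)"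
    and \<phi>2: "\<And>a1 a2. \<lbrakk>a1 \<in> carrier A; a2 \<in> carrier B\<rbrakk> \<Longrightarrow> bilinear_map K A B W (\<lambda>b1 b2. \<phi> a1 a2 b1 b2)"
  shows "\<exists>f. bilinear_map K T T W f \<and>
    (\<forall>a1 \<in> carrier A. \<forall>a2 \<in> carrier B. \<forall>b1 \<in> carrier A. \<forall>b2 \<in> carrier B.
       f (a1 \<otimes>\<^sub>T a2) (b1 \<otimes>\<^sub>T b2) = \<phi> a1 a2 b1 b2)"
proof -
  interpret W: module K W by (rule W)
  have "\<exists>h. \<forall>b1\<in>carrier A. \<forall>b2\<in>carrier B. h b1 b2 \<in> module_hom K T W \<and>
      (\<forall>a1\<in>carrier A. \<forall>a2\<in>carrier B. h b1 b2 (a1 \<otimes>\<^sub>T a2) = \<phi> a1 a2 b1 b2)"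
    using tensor_lift[OF W \<phi>1] by metis
  then obtain h where h: "\<And>b1 b2. \<lbrakk>b1 \<in> carrier A; b2 \<in> carrier B\<rbrakk> \<Longrightarrow> h b1 b2 \<in> module_hom K T W"
    and h\<phi>: "\<And>a1 a2 b1 b2. \<lbrakk>a1 \<in> carrier A; a2 \<in> carrier B; b1 \<in> carrier A; b2 \<in> carrier B\<rbrakk> \<Longrightarrow>
      h b1 b2 (a1 \<otimes>\<^sub>T a2) = \<phi> a1 a2 b1 b2"
    by blast
  note in2 = module_hom_in[OF h] and add2 = module_hom_add[OF h] and smult2 = module_hom_smult[OF h]
  have hom_add: "(\<lambda>x. u x \<oplus>\<^bsub>W\<^esub> v x) \<in> module_hom K T W"
    if u: "u \<in> module_hom K T W" and v: "v \<in> module_hom K T W" for u v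
    by (rule module_homI)
       (auto simp: module_hom_in[OF u] module_hom_in[OF v] module_hom_add[OF u] module_hom_add[OF v]
         module_hom_smult[OF u] module_hom_smult[OF v] W.smult_r_distr W.a_ac)
  have hom_smult: "(\<lambda>x. c \<odot>\<^bsub>W\<^esub> u x) \<in> module_hom K T W"
    if u: "u \<in> module_hom K T W" and c: "c \<in> carrier K" for u c
  proof (rule module_homI)
    show "c \<odot>\<^bsub>W\<^esub> u (d \<odot>\<^bsub>T\<^esub> x) = d \<odot>\<^bsub>W\<^esub> (c \<odot>\<^bsub>W\<^esub> u x)"
      if "d \<in> carrier K" "x \<in> carrier T" for d x
      using c that module_hom_in[OF u that(2)] module_hom_smult[OF u that]
      by (metis A.m_comm W.smult_assoc1)
  qed (use c in \<open>auto simp: module_hom_in[OF u] module_hom_add[OF u] W.smult_r_distr\<close>)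
  have bil: "bilinear_map K A B W (\<lambda>b1 b2. h b1 b2 x)" if x: "x \<in> carrier T" for x
  proof -
    have "h (b1 \<oplus>\<^bsub>A\<^esub> b1') b2 x = h b1 b2 x \<oplus>\<^bsub>W\<^esub> h b1' b2 x"
      if "b1 \<in> carrier A" "b1' \<in> carrier A" "b2 \<in> carrier B" for b1 b1' b2
      by (rule tensor_hom_eqI[OF W h hom_add[OF h h] _ x])
         (use that \<phi>2 in \<open>auto simp: h\<phi> bilinear_map_def module_hom_def\<close>)
    moreover have "h b1 (b2 \<oplus>\<^bsub>B\<^esub> b2') x = h b1 b2 x \<oplus>\<^bsub>W\<^esub> h b1 b2' x"
      if "b1 \<in> carrier A" "b2 \<in> carrier B" "b2' \<in> carrier B" for b1 b2 b2'
      by (rule tensor_hom_eqI[OF W h hom_add[OF h h] _ x])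
         (use that \<phi>2 in \<open>auto simp: h\<phi> bilinear_map_def module_hom_def\<close>)
    moreover have "h (c \<odot>\<^bsub>A\<^esub> b1) b2 x = c \<odot>\<^bsub>W\<^esub> h b1 b2 x"
      if "c \<in> carrier K" "b1 \<in> carrier A" "b2 \<in> carrier B" for c b1 b2
      by (rule tensor_hom_eqI[OF W h hom_smult[OF h] _ x])
         (use that \<phi>2 in \<open>auto simp: h\<phi> bilinear_map_def module_hom_def\<close>)
    moreover have "h b1 (c \<odot>\<^bsub>B\<^esub> b2) x = c \<odot>\<^bsub>W\<^esub> h b1 b2 x"
      if "c \<in> carrier K" "b1 \<in> carrier A" "b2 \<in> carrier B" for c b1 b2
      by (rule tensor_hom_eqI[OF W h hom_smult[OF h] _ x])
         (use that \<phi>2 in \<open>auto simp: h\<phi> bilinear_map_def module_hom_def\<close>)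
    ultimately show ?thesis
      unfolding bilinear_map_def by (auto intro!: module_homI in2 x)
  qed
  have "\<exists>f. \<forall>x\<in>carrier T. f x \<in> module_hom K T W \<and>
      (\<forall>b1\<in>carrier A. \<forall>b2\<in>carrier B. f x (b1 \<otimes>\<^sub>T b2) = h b1 b2 x)"
    using tensor_lift[OF W bil] by metis
  then obtain f where f: "\<And>x. x \<in> carrier T \<Longrightarrow> f x \<in> module_hom K T W"
    and fh: "\<And>x b1 b2. \<lbrakk>x \<in> carrier T; b1 \<in> carrier A; b2 \<in> carrier B\<rbrakk> \<Longrightarrow> f x (b1 \<otimes>\<^sub>T b2) = h b1 b2 x"
    by blast
  have "(\<lambda>x. f x y) \<in> module_hom K T W" if y: "y \<in> carrier T" for y
  proof (rule module_homI)
    fix x x' assume x: "x \<in> carrier T" and x': "x' \<in> carrier T"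
    show "f (x \<oplus>\<^bsub>T\<^esub> x') y = f x y \<oplus>\<^bsub>W\<^esub> f x' y"
      by (rule tensor_hom_eqI[OF W f hom_add[OF f f] _ y]) (use x x' in \<open>auto simp: fh add2\<close>)
  next
    fix c x assume c: "c \<in> carrier K" and x: "x \<in> carrier T"
    show "f (c \<odot>\<^bsub>T\<^esub> x) y = c \<odot>\<^bsub>W\<^esub> f x y"
      by (rule tensor_hom_eqI[OF W f hom_smult[OF f] _ y]) (use x c in \<open>auto simp: fh smult2\<close>)
  qed (use y f in \<open>auto intro: module_hom_in\<close>)
  hence "bilinear_map K T T W f" using f by (simp add: bilinear_map_def)
  thus ?thesis using fh h\<phi> pure_tensor_closed by (intro exI[of _ f]) simp
qed

lemma tensor_extension:
  assumes "module K W"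
    and "\<And>b1 b2. \<lbrakk>b1 \<in> carrier A; b2 \<in> carrier B\<rbrakk> \<Longrightarrow> bilinear_map K A B W (\<lambda>a1 a2. \<phi> a1 a2 b1 b2)"
    and "\<And>a1 a2. \<lbrakk>a1 \<in> carrier A; a2 \<in> carrier B\<rbrakk> \<Longrightarrow> bilinear_map K A B W (\<lambda>b1 b2. \<phi> a1 a2 b1 b2)"
  shows "bilinear_map K T T W (tensor_extension K A B W \<phi>)"
    and "\<lbrakk>a1 \<in> carrier A; a2 \<in> carrier B; b1 \<in> carrier A; b2 \<in> carrier B\<rbrakk> \<Longrightarrow>
      tensor_extension K A B W \<phi> (a1 \<otimes>\<^sub>T a2) (b1 \<otimes>\<^sub>T b2) = \<phi> a1 a2 b1 b2"
  using someI_ex[OF tensor_extension_exists[OF assms]] unfolding tensor_extension_def by auto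

lemma tensor_extension_unique:
  assumes W: "module K W" and f: "bilinear_map K T T W f" and f': "bilinear_map K T T W f'"
    and eq: "\<And>a1 a2 b1 b2. \<lbrakk>a1 \<in> carrier A; a2 \<in> carrier B; b1 \<in> carrier A; b2 \<in> carrier B\<rbrakk> \<Longrightarrow>
      f (a1 \<otimes>\<^sub>T a2) (b1 \<otimes>\<^sub>T b2) = f' (a1 \<otimes>\<^sub>T a2) (b1 \<otimes>\<^sub>T b2)"
    and x: "x \<in> carrier T" and y: "y \<in> carrier T"
  shows "f x y = f' x y"
proof (rule tensor_hom_eqI[OF W _ _ _ x])
  show "(\<lambda>x. f x y) \<in> module_hom K T W" "(\<lambda>x. f' x y) \<in> module_hom K T W"
    using f f' y by (simp_all add: bilinear_map_def)
  show "f (a1 \<otimes>\<^sub>T a2) y = f' (a1 \<otimes>\<^sub>T a2) y" if a: "a1 \<in> carrier A" "a2 \<in> carrier B" for a1 a2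
  proof (rule tensor_hom_eqI[OF W _ _ _ y])
    show "f (a1 \<otimes>\<^sub>T a2) \<in> module_hom K T W" "f' (a1 \<otimes>\<^sub>T a2) \<in> module_hom K T W"
      using f f' a by (simp_all add: bilinear_map_def pure_tensor_closed)
  qed (use a eq in auto)
qed

lemma pure_tensor_hom_bilinear:
  assumes u: "u \<in> module_hom K A A" and v: "v \<in> module_hom K B B"
  shows "bilinear_map K A B T (\<lambda>a b. u a \<otimes>\<^sub>T v b)"
  unfolding bilinear_map_def
  by (intro conjI ballI module_homI)
     (simp_all add: module_hom_in[OF u] module_hom_in[OF v] module_hom_add[OF u] module_hom_add[OF v]
       module_hom_smult[OF u] module_hom_smult[OF v] pure_tensor_closed pure_tensor_add_left
       pure_tensor_add_right pure_tensor_smult_left pure_tensor_smult_right)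

lemma bilinear_map_diff:
  assumes u: "bilinear_map K A B T u" and v: "bilinear_map K A B T v"
  shows "bilinear_map K A B T (\<lambda>a b. u a b \<ominus>\<^bsub>T\<^esub> v a b)"
proof -
  have diff: "(\<lambda>x. p x \<ominus>\<^bsub>T\<^esub> q x) \<in> module_hom K M T"
    if p: "p \<in> module_hom K M T" and q: "q \<in> module_hom K M T" for p q and M :: "('k, 'v, 'l) module_scheme"
  proof (rule module_homI)
    fix x y assume x: "x \<in> carrier M" and y: "y \<in> carrier M"
    note c = module_hom_in[OF p x] module_hom_in[OF q x] module_hom_in[OF p y] module_hom_in[OF q y]
    show "p x \<ominus>\<^bsub>T\<^esub> q x \<in> carrier T" using c by simp
    show "p (x \<oplus>\<^bsub>M\<^esub> y) \<ominus>\<^bsub>T\<^esub> q (x \<oplus>\<^bsub>M\<^esub> y) = (p x \<ominus>\<^bsub>T\<^esub> q x) \<oplus>\<^bsub>T\<^esub> (p y \<ominus>\<^bsub>T\<^esub> q y)"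
      using c by (simp add: module_hom_add[OF p x y] module_hom_add[OF q x y] a_minus_def
          T.minus_add T.a_ac)
  next
    fix c x assume c: "c \<in> carrier K" and x: "x \<in> carrier M"
    show "p (c \<odot>\<^bsub>M\<^esub> x) \<ominus>\<^bsub>T\<^esub> q (c \<odot>\<^bsub>M\<^esub> x) = c \<odot>\<^bsub>T\<^esub> (p x \<ominus>\<^bsub>T\<^esub> q x)"
      using c module_hom_in[OF p x] module_hom_in[OF q x]
      by (simp add: module_hom_smult[OF p c x] module_hom_smult[OF q c x] a_minus_def
          T.smult_r_distr T.smult_r_minus)
  qed
  show ?thesis using u v unfolding bilinear_map_def by (auto intro!: diff)
qed

lemma ground_module_is_module: "module K (ground_module K)"
  by (rule module_criteria)
     (auto simp: ground_module_def A.is_cring A.R.a_ac A.m_assoc A.l_distr A.r_distr A.r_neg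
       intro: bexI[of _ "\<ominus>\<^bsub>K\<^esub> _"])

lemma tensor_algebra_mult:
  assumes "bilinear_map K A A A (mult A)" and "bilinear_map K B B B (mult B)"
  shows "bilinear_map K T T T (mult (tensor_algebra K A B))"
    and "\<lbrakk>a1 \<in> carrier A; a2 \<in> carrier B; b1 \<in> carrier A; b2 \<in> carrier B\<rbrakk> \<Longrightarrow>
      (a1 \<otimes>\<^sub>T a2) \<otimes>\<^bsub>tensor_algebra K A B\<^esub> (b1 \<otimes>\<^sub>T b2) =
        (a1 \<otimes>\<^bsub>A\<^esub> b1) \<otimes>\<^sub>T (a2 \<otimes>\<^bsub>B\<^esub> b2)"
  unfolding tensor_algebra_def
  using tensor_extension[of "tensor_space K A B"
      "\<lambda>a1 a2 b1 b2. (a1 \<otimes>\<^bsub>A\<^esub> b1) \<otimes>\<^sub>T (a2 \<otimes>\<^bsub>B\<^esub> b2)", OF tensor_space_is_module]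
    pure_tensor_hom_bilinear assms
  by (simp_all add: bilinear_map_def[of K A A A] bilinear_map_def[of K B B B])

lemma tensor_bracket:
  assumes circ: "bilinear_map K A A A circ" and diamond: "bilinear_map K B B B diamond"
  shows "bilinear_map K T T T (tensor_bracket K A B circ diamond)"
    and "\<lbrakk>a1 \<in> carrier A; a2 \<in> carrier B; b1 \<in> carrier A; b2 \<in> carrier B\<rbrakk> \<Longrightarrow>
      tensor_bracket K A B circ diamond (a1 \<otimes>\<^sub>T a2) (b1 \<otimes>\<^sub>T b2) =
        (circ a1 b1 \<otimes>\<^sub>T diamond a2 b2) \<ominus>\<^bsub>T\<^esub> (circ b1 a1 \<otimes>\<^sub>T diamond b2 a2)"
  unfolding tensor_bracket_def
  using tensor_extension[of "tensor_space K A B"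
      "\<lambda>a1 a2 b1 b2. (circ a1 b1 \<otimes>\<^sub>T diamond a2 b2) \<ominus>\<^bsub>T\<^esub> (circ b1 a1 \<otimes>\<^sub>T diamond b2 a2)",
      OF tensor_space_is_module]
    bilinear_map_diff[OF pure_tensor_hom_bilinear pure_tensor_hom_bilinear] assms
  by (simp_all add: bilinear_map_def[of K A A A] bilinear_map_def[of K B B B])

lemma tensor_form:
  assumes formA: "bilinear_map K A A (ground_module K) formA"
    and formB: "bilinear_map K B B (ground_module K) formB"
  shows "bilinear_map K T T (ground_module K) (tensor_form K A B formA formB)"
    and "\<lbrakk>a1 \<in> carrier A; a2 \<in> carrier B; b1 \<in> carrier A; b2 \<in> carrier B\<rbrakk> \<Longrightarrow>
      tensor_form K A B formA formB (a1 \<otimes>\<^sub>T a2) (b1 \<otimes>\<^sub>T b2) = formA a1 b1 \<otimes>\<^bsub>K\<^esub> formB a2 b2"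
proof -
  have prod: "bilinear_map K A B (ground_module K) (\<lambda>a b. u a \<otimes>\<^bsub>K\<^esub> v b)"
    if u: "u \<in> module_hom K A (ground_module K)" and v: "v \<in> module_hom K B (ground_module K)" for u v
    unfolding bilinear_map_def
    using module_hom_in[OF u] module_hom_in[OF v] module_hom_add[OF u] module_hom_add[OF v]
       module_hom_smult[OF u] module_hom_smult[OF v]
    by (intro conjI ballI module_homI)
       (simp_all add: ground_module_def A.l_distr A.r_distr A.m_ac)
  note ext = tensor_extension[of "ground_module K" "\<lambda>a1 a2 b1 b2. formA a1 b1 \<otimes>\<^bsub>K\<^esub> formB a2 b2",
      OF ground_module_is_module prod prod, folded tensor_form_def]
  show "bilinear_map K T T (ground_module K) (tensor_form K A B formA formB)"
    by (rule ext) (use formA formB in \<open>simp_all add: bilinear_map_def\<close>)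
  show "tensor_form K A B formA formB (a1 \<otimes>\<^sub>T a2) (b1 \<otimes>\<^sub>T b2) = formA a1 b1 \<otimes>\<^bsub>K\<^esub> formB a2 b2"
    if "a1 \<in> carrier A" "a2 \<in> carrier B" "b1 \<in> carrier A" "b2 \<in> carrier B"
    by (rule ext) (use formA formB that in \<open>simp_all add: bilinear_map_def\<close>)
qed

end

end

theory Submission
  imports Defs
begin

text \<open>
  Every identity to be shown is multilinear, so it suffices to check it on pure tensors
  (\<open>trilinear_eqI\<close>). Write \<open>\<star>\<close> for the Novikov product of \<open>A\<close> and
  \<open>x \<circ> y = y \<diamondop> x\<close> for that of \<open>B\<close>; then
  \<open>[a \<otimes> a', b \<otimes> b'] = (a \<star> b) \<otimes> (b' \<circ> a') - (b \<star> a) \<otimes> (a' \<circ> b')\<close>. The two factors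
  satisfy the same axioms, hence a normal form proved once for \<open>A\<close> also holds for \<open>B\<close>.

  Jacobi identity. In a Novikov algebra the twelve products of \<open>a\<close>, \<open>b\<close>, \<open>c\<close>, each taken once, are
  expressed through six elements: \<open>(x \<star> y) \<star> z\<close> depends only on \<open>x\<close>, say it is \<open>r x\<close>, and
  \<open>x \<star> (y \<star> z) - r x\<close> depends only on \<open>z\<close>, say it is \<open>m z\<close> (\<open>cubic_normal_form\<close>). With the
  corresponding elements \<open>s\<close>, \<open>n\<close> of \<open>B\<close>, put \<open>W x y = r x \<otimes> s y + r y \<otimes> s x\<close> and
  \<open>U x = m x \<otimes> s x + r x \<otimes> n x\<close>. For tensors \<open>x\<close>, \<open>y\<close>, \<open>z\<close> with first
  factors \<open>a\<close>, \<open>b\<close>, \<open>c\<close>, the bracket \<open>[x, [y, z]]\<close> is \<open>(U c + W a c) - (U b + W a b)\<close>, and since \<open>W\<close> is symmetric its cyclic sum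
  telescopes to zero (\<open>br_jacobi\<close>).

  Jacobi--Leibniz rule. Both sides become linear combinations of the same pure tensors after
  writing \<open>x \<star> a = x (1 \<star> a)\<close> and expanding \<open>a \<star> (b c)\<close> (\<open>circ_normal_form\<close>, \<open>br_mult\<close>).

  Invariance of the form. The invariance axiom says that the numbers \<open>\<B> (x, y \<star> z)\<close> sum to zero
  over certain triples of arrangements of \<open>a\<close>, \<open>b\<close>, \<open>c\<close>; comparing two such triples shows that
  \<open>\<B> (x, y \<star> z)\<close> depends only on \<open>z\<close>, and that its three values sum to zero
  (\<open>form_circ_normal_form\<close>). Invariance of the product form is then an identity between two
  expressions in the base field (\<open>fm_bracket\<close>).

  Nondegeneracy. Write \<open>x = \<Sum> \<alpha>\<^sub>s \<otimes> s\<close> over a basis of \<open>B\<close> (\<open>tensor_representation\<close>). If \<open>x\<close> is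
  orthogonal to all \<open>a \<otimes> b\<close>, then \<open>\<Sum> \<B> (\<alpha>\<^sub>s, a) s\<close> is orthogonal to \<open>B\<close>, hence zero; so
  \<open>\<B> (\<alpha>\<^sub>s, a) = 0\<close> for all \<open>a\<close> by linear independence, and each \<open>\<alpha>\<^sub>s\<close> vanishes
  (\<open>fm_nondegenerate\<close>).
\<close>

section \<open>Multilinear maps\<close>

lemma module_hom_ident: "(\<lambda>x. x) \<in> module_hom K V V"
  by (simp add: module_hom_def)

lemma module_hom_plus:
  assumes W: "module K W" and f: "f \<in> module_hom K V W" and g: "g \<in> module_hom K V W"
  shows "(\<lambda>x. f x \<oplus>\<^bsub>W\<^esub> g x) \<in> module_hom K V W"
proof -
  interpret W: module K W by (rule W)
  show ?thesis
    by (rule module_homI)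
       (auto simp: module_hom_in[OF f] module_hom_in[OF g] module_hom_add[OF f] module_hom_add[OF g]
         module_hom_smult[OF f] module_hom_smult[OF g] W.smult_r_distr W.a_ac)
qed

lemma module_hom_const_zero: "module K W \<Longrightarrow> (\<lambda>x. \<zero>\<^bsub>W\<^esub>) \<in> module_hom K V W"
proof -
  assume "module K W"
  then interpret W: module K W .
  show ?thesis by (rule module_homI) auto
qed

lemma module_hom_finsum:
  assumes V: "module K V" and W: "module K W" and f: "f \<in> module_hom K V W"
    and "finite S" and "g \<in> S \<rightarrow> carrier V"
  shows "f (finsum V g S) = finsum W (\<lambda>s. f (g s)) S"
proof -
  interpret V: module K V by (rule V)
  interpret W: module K W by (rule W)
  from \<open>finite S\<close> \<open>g \<in> S \<rightarrow> carrier V\<close> show ?thesis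
  proof (induction S)
    case empty
    show ?case by (simp add: module_hom_zero[OF V W f])
  next
    case (insert x S)
    hence "g x \<in> carrier V" "g \<in> S \<rightarrow> carrier V" by auto
    moreover from this have "(\<lambda>s. f (g s)) \<in> S \<rightarrow> carrier W" "f (g x) \<in> carrier W"
      by (auto intro: module_hom_in[OF f])
    ultimately show ?case using insert
      by (simp add: module_hom_add[OF f] V.finsum_closed)
  qed
qed

lemma submodule_vimage:
  assumes V: "module K V" and W: "module K W" and h: "h \<in> module_hom K V W" and N: "submodule K N W"
  shows "submodule K {v \<in> carrier V. h v \<in> N} V"
proof -
  interpret V: module K V by (rule V)
  interpret N: submodule K N W by (rule N)
  show ?thesis
    by (rule submodule.intro)
       (use V in \<open>auto simp: module_hom_add[OF h] module_hom_smult[OF h] module_hom_zero[OF V W h]\<close>)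
qed

lemma bilinear_map_closed:
  "\<lbrakk>bilinear_map K U V W f; u \<in> carrier U; v \<in> carrier V\<rbrakk> \<Longrightarrow> f u v \<in> carrier W"
  unfolding bilinear_map_def using module_hom_in by fast

lemma bilinear_map_left:
  assumes f: "bilinear_map K U V W f" and u: "u \<in> module_hom K M U" and v: "v \<in> carrier V"
  shows "(\<lambda>x. f (u x) v) \<in> module_hom K M W"
proof -
  have fv: "(\<lambda>u. f u v) \<in> module_hom K U W" using f v by (simp add: bilinear_map_def)
  show ?thesis
    by (rule module_homI)
       (simp_all add: module_hom_in[OF u] module_hom_add[OF u] module_hom_smult[OF u]
         module_hom_in[OF fv] module_hom_add[OF fv] module_hom_smult[OF fv])
qed

lemma bilinear_map_right:
  assumes f: "bilinear_map K U V W f" and u: "u \<in> carrier U" and v: "v \<in> module_hom K M V"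
  shows "(\<lambda>x. f u (v x)) \<in> module_hom K M W"
proof -
  have fu: "(\<lambda>v. f u v) \<in> module_hom K V W" using f u by (simp add: bilinear_map_def)
  show ?thesis
    by (rule module_homI)
       (simp_all add: module_hom_in[OF v] module_hom_add[OF v] module_hom_smult[OF v]
         module_hom_in[OF fu] module_hom_add[OF fu] module_hom_smult[OF fu])
qed

lemma bilinear_map_flip: "bilinear_map K U V W f \<Longrightarrow> bilinear_map K V U W (\<lambda>v u. f u v)"
  by (simp add: bilinear_map_def)

lemma bilinear_map_minus_left:
  assumes "module K U" "module K W" "bilinear_map K U V W f"
    and "u \<in> carrier U" "u' \<in> carrier U" "v \<in> carrier V"
  shows "f (u \<ominus>\<^bsub>U\<^esub> u') v = f u v \<ominus>\<^bsub>W\<^esub> f u' v"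
  using module_hom_minus[of K U W "\<lambda>u. f u v"] assms by (simp add: bilinear_map_def)

lemma bilinear_map_minus_right:
  assumes "module K V" "module K W" "bilinear_map K U V W f"
    and "u \<in> carrier U" "v \<in> carrier V" "v' \<in> carrier V"
  shows "f u (v \<ominus>\<^bsub>V\<^esub> v') = f u v \<ominus>\<^bsub>W\<^esub> f u v'"
  using module_hom_minus[of K V W "\<lambda>v. f u v"] assms by (simp add: bilinear_map_def)

lemma (in algebra) mult_bilinear: "bilinear_map R M M M (mult M)"
proof -
  have "x \<otimes>\<^bsub>M\<^esub> (c \<odot>\<^bsub>M\<^esub> y) = c \<odot>\<^bsub>M\<^esub> (x \<otimes>\<^bsub>M\<^esub> y)"
    if "c \<in> carrier R" "x \<in> carrier M" "y \<in> carrier M" for c x y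
    using that smult_assoc2[of c y x] by (simp add: m_comm)
  thus ?thesis
    unfolding bilinear_map_def
    by (auto intro!: module_homI simp: l_distr r_distr smult_assoc2)
qed

text \<open>
  Identities between signed sums in an abelian group are decided by moving both sides to the form
  \<open>p \<ominus> q\<close> with \<open>p\<close> and \<open>q\<close> sums of unsigned terms, and comparing \<open>p \<oplus> q'\<close> with \<open>p' \<oplus> q\<close> up to
  associativity and commutativity; no cancellation is ever needed.
\<close>

lemma (in abelian_group) diff_normalize:
  "\<lbrakk>a \<in> carrier G; b \<in> carrier G; c \<in> carrier G\<rbrakk> \<Longrightarrow> (a \<ominus> b) \<oplus> c = (a \<oplus> c) \<ominus> b"
  "\<lbrakk>a \<in> carrier G; b \<in> carrier G; c \<in> carrier G\<rbrakk> \<Longrightarrow> a \<oplus> (b \<ominus> c) = (a \<oplus> b) \<ominus> c"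
  "\<lbrakk>a \<in> carrier G; b \<in> carrier G; c \<in> carrier G\<rbrakk> \<Longrightarrow> (a \<ominus> b) \<ominus> c = a \<ominus> (b \<oplus> c)"
  "\<lbrakk>a \<in> carrier G; b \<in> carrier G; c \<in> carrier G\<rbrakk> \<Longrightarrow> a \<ominus> (b \<ominus> c) = (a \<oplus> c) \<ominus> b"
  by (simp_all add: a_minus_def minus_add a_ac)

lemma (in abelian_group) diff_eq_iff:
  "\<lbrakk>a \<in> carrier G; b \<in> carrier G; c \<in> carrier G\<rbrakk> \<Longrightarrow> a \<ominus> b = c \<longleftrightarrow> a = c \<oplus> b"
  "\<lbrakk>a \<in> carrier G; b \<in> carrier G; c \<in> carrier G\<rbrakk> \<Longrightarrow> c = a \<ominus> b \<longleftrightarrow> c \<oplus> b = a"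
proof -
  show *: "a \<ominus> b = c \<longleftrightarrow> a = c \<oplus> b" if "a \<in> carrier G" "b \<in> carrier G" "c \<in> carrier G" for a b c
    using that by (metis a_assoc a_inv_closed a_minus_def l_neg r_neg r_zero)
  show "c = a \<ominus> b \<longleftrightarrow> c \<oplus> b = a" if "a \<in> carrier G" "b \<in> carrier G" "c \<in> carrier G" for a b c
    using *[OF that] by metis
qed

section \<open>The tensor product of two modules\<close>

locale tensor_of_modules = A: module K A + B: module K B
  for K :: "('k, 'r) ring_scheme"
    and A :: "('k, 'a, 'm) module_scheme" and B :: "('k, 'b, 'n) module_scheme"
begin

abbreviation (input) "T \<equiv> tensor_space K A B"
abbreviation (input) tens (infixl "\<otimes>\<^sub>T" 75) where "a \<otimes>\<^sub>T b \<equiv> pure_tensor K A B a b"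

sublocale T: module K "tensor_space K A B"
  by (rule tensor_space_is_module[OF A.module_axioms B.module_axioms])

lemmas pure_closed = pure_tensor_closed[OF A.module_axioms B.module_axioms]
lemmas pure_bilinear = pure_tensor_bilinear[OF A.module_axioms B.module_axioms]
lemmas pure_add_left = pure_tensor_add_left[OF A.module_axioms B.module_axioms]
lemmas pure_add_right = pure_tensor_add_right[OF A.module_axioms B.module_axioms]
lemmas pure_smult_left = pure_tensor_smult_left[OF A.module_axioms B.module_axioms]
lemmas pure_smult_right = pure_tensor_smult_right[OF A.module_axioms B.module_axioms]
lemmas pure_minus_left =
  bilinear_map_minus_left[OF A.module_axioms T.module_axioms pure_bilinear]
lemmas pure_minus_right =
  bilinear_map_minus_right[OF B.module_axioms T.module_axioms pure_bilinear]
lemmas hom_eqI = tensor_hom_eqI[OF A.module_axioms B.module_axioms]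

text \<open>
  Since pure tensors span, two linear maps agreeing on them are equal; apply this to one argument
  at a time, with the arguments before it already pure.
\<close>

lemma trilinear_eqI:
  assumes W: "module K W"
    and f1: "\<And>y z. \<lbrakk>y \<in> carrier T; z \<in> carrier T\<rbrakk> \<Longrightarrow> (\<lambda>x. f x y z) \<in> module_hom K T W"
    and f2: "\<And>x z. \<lbrakk>x \<in> carrier T; z \<in> carrier T\<rbrakk> \<Longrightarrow> (\<lambda>y. f x y z) \<in> module_hom K T W"
    and f3: "\<And>x y. \<lbrakk>x \<in> carrier T; y \<in> carrier T\<rbrakk> \<Longrightarrow> (\<lambda>z. f x y z) \<in> module_hom K T W"
    and g1: "\<And>y z. \<lbrakk>y \<in> carrier T; z \<in> carrier T\<rbrakk> \<Longrightarrow> (\<lambda>x. g x y z) \<in> module_hom K T W"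
    and g2: "\<And>x z. \<lbrakk>x \<in> carrier T; z \<in> carrier T\<rbrakk> \<Longrightarrow> (\<lambda>y. g x y z) \<in> module_hom K T W"
    and g3: "\<And>x y. \<lbrakk>x \<in> carrier T; y \<in> carrier T\<rbrakk> \<Longrightarrow> (\<lambda>z. g x y z) \<in> module_hom K T W"
    and eq: "\<And>a a' b b' c c'. \<lbrakk>a \<in> carrier A; a' \<in> carrier B; b \<in> carrier A; b' \<in> carrier B;
        c \<in> carrier A; c' \<in> carrier B\<rbrakk> \<Longrightarrow>
      f (a \<otimes>\<^sub>T a') (b \<otimes>\<^sub>T b') (c \<otimes>\<^sub>T c') = g (a \<otimes>\<^sub>T a') (b \<otimes>\<^sub>T b') (c \<otimes>\<^sub>T c')"
    and x: "x \<in> carrier T" and y: "y \<in> carrier T" and z: "z \<in> carrier T"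
  shows "f x y z = g x y z"
proof (rule hom_eqI[OF W f1[OF y z] g1[OF y z] _ x])
  fix a a' assume a: "a \<in> carrier A" "a' \<in> carrier B"
  note aT = pure_closed[OF a]
  show "f (a \<otimes>\<^sub>T a') y z = g (a \<otimes>\<^sub>T a') y z"
  proof (rule hom_eqI[OF W f2[OF aT z] g2[OF aT z] _ y])
    fix b b' assume b: "b \<in> carrier A" "b' \<in> carrier B"
    note bT = pure_closed[OF b]
    show "f (a \<otimes>\<^sub>T a') (b \<otimes>\<^sub>T b') z = g (a \<otimes>\<^sub>T a') (b \<otimes>\<^sub>T b') z"
      by (rule hom_eqI[OF W f3[OF aT bT] g3[OF aT bT] eq[OF a b] z])
  qed
qed

text \<open>
  The tensor algebra has the same underlying module as the tensor space, so that the identities are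
  proved in the latter and carried over at the end.
\<close>

lemma tensor_algebra_simps:
  "carrier (tensor_algebra K A B) = carrier T"
  "\<zero>\<^bsub>tensor_algebra K A B\<^esub> = \<zero>\<^bsub>T\<^esub>"
  "x \<oplus>\<^bsub>tensor_algebra K A B\<^esub> y = x \<oplus>\<^bsub>T\<^esub> y"
  "c \<odot>\<^bsub>tensor_algebra K A B\<^esub> x = c \<odot>\<^bsub>T\<^esub> x"
  "\<one>\<^bsub>tensor_algebra K A B\<^esub> = \<one>\<^bsub>A\<^esub> \<otimes>\<^sub>T \<one>\<^bsub>B\<^esub>"
  by (simp_all add: tensor_algebra_def)

lemma tensor_algebra_module: "module K (tensor_algebra K A B)"
  by (intro moduleI abelian_groupI)
     (auto simp: tensor_algebra_simps A.is_cring T.a_ac T.smult_l_distr T.smult_r_distr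
       T.smult_assoc1 intro: T.l_neg bexI[of _ "\<ominus>\<^bsub>T\<^esub> _"])

lemma tensor_algebra_bilinear:
  "bilinear_map K (tensor_algebra K A B) (tensor_algebra K A B) W f \<longleftrightarrow> bilinear_map K T T W f"
  "bilinear_map K T T (tensor_algebra K A B) g \<longleftrightarrow> bilinear_map K T T T g"
  by (simp_all add: bilinear_map_def module_hom_def tensor_algebra_simps)

lemma tensor_algebra_span: "module.span K (tensor_algebra K A B) S = T.span S"
proof -
  have "add (tensor_algebra K A B) = add T" by (intro ext) (rule tensor_algebra_simps)
  thus ?thesis
    by (simp add: module.span_def[OF tensor_algebra_module] T.span_def T.lincomb_def
      module.lincomb_def[OF tensor_algebra_module] finsum_def finprod_def tensor_algebra_simps)
qed

text \<open>
  The vectors \<open>a\<close> with \<open>a \<otimes> b\<close> in a given submodule form a submodule of \<open>A\<close>. It contains the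
  generators of \<open>A\<close> when \<open>b\<close> is a generator of \<open>B\<close>, hence all of \<open>A\<close>; exchanging the roles of the
  factors then admits every \<open>b\<close>.
\<close>

lemma tensor_space_span:
  assumes E: "E \<subseteq> carrier A" "A.span E = carrier A" and F: "F \<subseteq> carrier B" "B.span F = carrier B"
  shows "T.span ((\<lambda>(a, b). a \<otimes>\<^sub>T b) ` (E \<times> F)) = carrier T"
proof
  define P where "P = T.span ((\<lambda>(a, b). a \<otimes>\<^sub>T b) ` (E \<times> F))"
  have sub: "(\<lambda>(a, b). a \<otimes>\<^sub>T b) ` (E \<times> F) \<subseteq> carrier T"
    using E F by (auto intro!: pure_closed)
  have P: "submodule K P T" unfolding P_def by (rule T.span_is_submodule[OF sub])
  interpret P: submodule K P T by (rule P)
  show "T.span ((\<lambda>(a, b). a \<otimes>\<^sub>T b) ` (E \<times> F)) \<subseteq> carrier T"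
    by (rule T.span_is_subset2[OF sub])
  have gen: "a \<otimes>\<^sub>T b \<in> P" if "a \<in> E" "b \<in> F" for a b
    using T.in_own_span[OF sub] that unfolding P_def by blast
  have left: "a \<otimes>\<^sub>T b \<in> P" if a: "a \<in> carrier A" and b: "b \<in> F" for a b
  proof -
    have "submodule K {a \<in> carrier A. a \<otimes>\<^sub>T b \<in> P} A"
      by (rule submodule_vimage[OF A.module_axioms T.module_axioms _ P])
         (use b F pure_bilinear in \<open>auto simp: bilinear_map_def\<close>)
    moreover have "E \<subseteq> {a \<in> carrier A. a \<otimes>\<^sub>T b \<in> P}" using E gen b by auto
    ultimately have "A.span E \<subseteq> {a \<in> carrier A. a \<otimes>\<^sub>T b \<in> P}" using A.span_is_subset by blast
    thus ?thesis using a E by auto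
  qed
  have pure: "a \<otimes>\<^sub>T b \<in> P" if a: "a \<in> carrier A" and b: "b \<in> carrier B" for a b
  proof -
    have "submodule K {b \<in> carrier B. a \<otimes>\<^sub>T b \<in> P} B"
      by (rule submodule_vimage[OF B.module_axioms T.module_axioms _ P])
         (use a pure_bilinear in \<open>auto simp: bilinear_map_def\<close>)
    moreover have "F \<subseteq> {b \<in> carrier B. a \<otimes>\<^sub>T b \<in> P}" using F left a by auto
    ultimately have "B.span F \<subseteq> {b \<in> carrier B. a \<otimes>\<^sub>T b \<in> P}" using B.span_is_subset by blast
    thus ?thesis using b F by auto
  qed
  have "x \<in> P" if "x \<in> carrier T" for x
    by (rule tensor_space_induct[OF A.module_axioms B.module_axioms _ pure that])
       (auto simp: lincomb_closed_set_def)
  thus "carrier T \<subseteq> T.span ((\<lambda>(a, b). a \<otimes>\<^sub>T b) ` (E \<times> F))" unfolding P_def by blast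
qed

text \<open>
  The tensors of this shape are closed under linear combinations, coefficient by coefficient, and
  expanding \<open>b\<close> in the generators \<open>s\<close> of \<open>B\<close> moves the scalars of \<open>a \<otimes> b\<close> to the left factors.
\<close>

lemma tensor_representation:
  assumes S: "finite S" "S \<subseteq> carrier B" "B.span S = carrier B" and x: "x \<in> carrier T"
  obtains \<alpha> where "\<alpha> \<in> S \<rightarrow> carrier A" and "x = (\<Oplus>\<^bsub>T\<^esub>s\<in>S. \<alpha> s \<otimes>\<^sub>T s)"
proof -
  define P where "P = {(\<Oplus>\<^bsub>T\<^esub>s\<in>S. \<alpha> s \<otimes>\<^sub>T s) | \<alpha>. \<alpha> \<in> S \<rightarrow> carrier A}"
  have summand: "(\<lambda>s. \<alpha> s \<otimes>\<^sub>T s) \<in> S \<rightarrow> carrier T" if "\<alpha> \<in> S \<rightarrow> carrier A" for \<alpha>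
    using that S by (auto intro!: pure_closed)
  have "x \<in> P"
  proof (rule tensor_space_induct[OF A.module_axioms B.module_axioms _ _ x])
    show "lincomb_closed_set K T P"
      unfolding lincomb_closed_set_def
    proof (intro conjI ballI)
      have "\<zero>\<^bsub>A\<^esub> \<otimes>\<^sub>T s = \<zero>\<^bsub>T\<^esub>" if "s \<in> S" for s
        using module_hom_zero[OF A.module_axioms T.module_axioms, of "\<lambda>a. a \<otimes>\<^sub>T s"] that S
          pure_bilinear by (auto simp: bilinear_map_def)
      hence "(\<Oplus>\<^bsub>T\<^esub>s\<in>S. \<zero>\<^bsub>A\<^esub> \<otimes>\<^sub>T s) = \<zero>\<^bsub>T\<^esub>"
        by (simp add: T.add.finprod_one_eqI)
      thus "\<zero>\<^bsub>T\<^esub> \<in> P" unfolding P_def by (auto intro!: exI[of _ "\<lambda>s. \<zero>\<^bsub>A\<^esub>"])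
    next
      fix u v assume "u \<in> P" "v \<in> P"
      then obtain \<alpha> \<beta> where \<alpha>: "\<alpha> \<in> S \<rightarrow> carrier A" "u = (\<Oplus>\<^bsub>T\<^esub>s\<in>S. \<alpha> s \<otimes>\<^sub>T s)"
        and \<beta>: "\<beta> \<in> S \<rightarrow> carrier A" "v = (\<Oplus>\<^bsub>T\<^esub>s\<in>S. \<beta> s \<otimes>\<^sub>T s)"
        unfolding P_def by auto
      have "u \<oplus>\<^bsub>T\<^esub> v = (\<Oplus>\<^bsub>T\<^esub>s\<in>S. \<alpha> s \<otimes>\<^sub>T s \<oplus>\<^bsub>T\<^esub> \<beta> s \<otimes>\<^sub>T s)"
        unfolding \<alpha>(2) \<beta>(2) by (rule T.finsum_addf[symmetric]) (use summand \<alpha> \<beta> in auto)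
      also have "\<dots> = (\<Oplus>\<^bsub>T\<^esub>s\<in>S. (\<alpha> s \<oplus>\<^bsub>A\<^esub> \<beta> s) \<otimes>\<^sub>T s)"
        by (rule T.add.finprod_cong') (use \<alpha> \<beta> S in \<open>auto simp: pure_add_left Pi_def subset_iff pure_closed\<close>)
      finally show "u \<oplus>\<^bsub>T\<^esub> v \<in> P"
        unfolding P_def using \<alpha> \<beta> by (auto intro!: exI[of _ "\<lambda>s. \<alpha> s \<oplus>\<^bsub>A\<^esub> \<beta> s"])
    next
      fix c u assume c: "c \<in> carrier K" and "u \<in> P"
      then obtain \<alpha> where \<alpha>: "\<alpha> \<in> S \<rightarrow> carrier A" "u = (\<Oplus>\<^bsub>T\<^esub>s\<in>S. \<alpha> s \<otimes>\<^sub>T s)"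
        unfolding P_def by auto
      have "c \<odot>\<^bsub>T\<^esub> u = (\<Oplus>\<^bsub>T\<^esub>s\<in>S. c \<odot>\<^bsub>T\<^esub> (\<alpha> s \<otimes>\<^sub>T s))"
        unfolding \<alpha>(2) by (rule T.finsum_smult_ldistr) (use c S summand \<alpha> in auto)
      also have "\<dots> = (\<Oplus>\<^bsub>T\<^esub>s\<in>S. (c \<odot>\<^bsub>A\<^esub> \<alpha> s) \<otimes>\<^sub>T s)"
        by (rule T.add.finprod_cong') (use c \<alpha> S in \<open>auto simp: pure_smult_left Pi_def subset_iff pure_closed\<close>)
      finally show "c \<odot>\<^bsub>T\<^esub> u \<in> P"
        unfolding P_def using \<alpha> c by (auto intro!: exI[of _ "\<lambda>s. c \<odot>\<^bsub>A\<^esub> \<alpha> s"])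
    qed
  next
    fix a b assume a: "a \<in> carrier A" and b: "b \<in> carrier B"
    obtain d where d: "d \<in> S \<rightarrow> carrier K" "b = (\<Oplus>\<^bsub>B\<^esub>s\<in>S. d s \<odot>\<^bsub>B\<^esub> s)"
      using B.finite_in_span[OF S(1,2)] S(3) b unfolding B.lincomb_def by metis
    have "a \<otimes>\<^sub>T b = (\<Oplus>\<^bsub>T\<^esub>s\<in>S. a \<otimes>\<^sub>T (d s \<odot>\<^bsub>B\<^esub> s))"
      unfolding d(2)
      by (rule module_hom_finsum[OF B.module_axioms T.module_axioms])
         (use a d S pure_bilinear in \<open>auto simp: bilinear_map_def\<close>)
    also have "\<dots> = (\<Oplus>\<^bsub>T\<^esub>s\<in>S. (d s \<odot>\<^bsub>A\<^esub> a) \<otimes>\<^sub>T s)"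
      by (rule T.add.finprod_cong')
         (use a d S in \<open>auto simp: pure_smult_left pure_smult_right Pi_def subset_iff pure_closed\<close>)
    finally show "a \<otimes>\<^sub>T b \<in> P"
      unfolding P_def using a d by (auto intro!: exI[of _ "\<lambda>s. d s \<odot>\<^bsub>A\<^esub> a"])
  qed
  thus ?thesis using that unfolding P_def by auto
qed

end


section \<open>The Lie bracket\<close>

text \<open>
  Right commutativity makes \<open>(x \<star> y) \<star> z\<close> depend on its first letter only. Left symmetry says that
  the negated associator \<open>x \<star> (y \<star> z) - (x \<star> y) \<star> z\<close> is symmetric in \<open>x\<close> and \<open>y\<close>, so it depends
  only on the third letter.
\<close>

lemma (in novikov_algebra) cubic_normal_form:
  assumes a: "a \<in> carrier A" and b: "b \<in> carrier A" and c: "c \<in> carrier A"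
  obtains r\<^sub>a r\<^sub>b r\<^sub>c m\<^sub>a m\<^sub>b m\<^sub>c
  where "r\<^sub>a \<in> carrier A" "r\<^sub>b \<in> carrier A" "r\<^sub>c \<in> carrier A"
    and "m\<^sub>a \<in> carrier A" "m\<^sub>b \<in> carrier A" "m\<^sub>c \<in> carrier A"
    and "(a \<star> b) \<star> c = r\<^sub>a" "(a \<star> c) \<star> b = r\<^sub>a" "(b \<star> a) \<star> c = r\<^sub>b"
    and "(b \<star> c) \<star> a = r\<^sub>b" "(c \<star> a) \<star> b = r\<^sub>c" "(c \<star> b) \<star> a = r\<^sub>c"
    and "a \<star> (b \<star> c) = r\<^sub>a \<oplus> m\<^sub>c" "b \<star> (a \<star> c) = r\<^sub>b \<oplus> m\<^sub>c"
    and "a \<star> (c \<star> b) = r\<^sub>a \<oplus> m\<^sub>b" "c \<star> (a \<star> b) = r\<^sub>c \<oplus> m\<^sub>b"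
    and "b \<star> (c \<star> a) = r\<^sub>b \<oplus> m\<^sub>a" "c \<star> (b \<star> a) = r\<^sub>c \<oplus> m\<^sub>a"
proof -
  note cl = bilinear_map_closed[OF circ_bilinear]
  \<comment> \<open>the negated associator\<close>
  define m where "m x y z = (x \<star> (y \<star> z)) \<ominus> ((x \<star> y) \<star> z)" for x y z
  have m_closed: "m x y z \<in> carrier A" if "x \<in> carrier A" "y \<in> carrier A" "z \<in> carrier A" for x y z
    using that by (simp add: m_def cl)
  have left: "x \<star> (y \<star> z) = ((x \<star> y) \<star> z) \<oplus> m x y z"
    if "x \<in> carrier A" "y \<in> carrier A" "z \<in> carrier A" for x y z
    using that by (simp add: m_def cl M.diff_normalize M.diff_eq_iff M.a_comm)
  have sym: "m x y z = m y x z" if "x \<in> carrier A" "y \<in> carrier A" "z \<in> carrier A" for x y z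
    using circ_left_symmetric[OF that] that
    by (simp add: m_def cl M.diff_normalize M.diff_eq_iff M.a_ac)
  show thesis
    by (rule that[of "(a \<star> b) \<star> c" "(b \<star> a) \<star> c" "(c \<star> a) \<star> b" "m b c a" "m a c b" "m a b c"])
       (use a b c left[of a b c] left[of b a c] left[of a c b] left[of c a b] left[of b c a] left[of c b a]
         circ_right_commute[of a b c] circ_right_commute[of b a c] circ_right_commute[of c a b]
         sym[of a b c] sym[of b c a] sym[of a c b] in \<open>auto simp: cl m_closed\<close>)
qed

locale tensor_of_novikov_algebras =
  A: novikov_algebra K A circ + B: novikov_algebra K B "\<lambda>a b. diamond b a"
  for K :: "('k, 'r) ring_scheme"
    and A :: "('k, 'a, 'm) module_scheme" and B :: "('k, 'b, 'n) module_scheme"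
    and circ :: "'a \<Rightarrow> 'a \<Rightarrow> 'a" (infixl "\<star>" 70) and diamond :: "'b \<Rightarrow> 'b \<Rightarrow> 'b" (infixl "\<diamondop>" 70)
begin

sublocale tensor_of_modules K A B ..

abbreviation (input) br where "br \<equiv> tensor_bracket K A B circ diamond"

lemma diamond_bilinear: "bilinear_map K B B B diamond"
  using bilinear_map_flip[OF B.circ_bilinear] .

lemmas circ_closed = bilinear_map_closed[OF A.circ_bilinear]
lemmas diamond_closed = bilinear_map_closed[OF diamond_bilinear]
lemmas br_bilinear =
  tensor_bracket(1)[OF A.module_axioms B.module_axioms A.circ_bilinear diamond_bilinear]
lemmas br_pure =
  tensor_bracket(2)[OF A.module_axioms B.module_axioms A.circ_bilinear diamond_bilinear]
lemmas br_closed = bilinear_map_closed[OF br_bilinear]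
lemmas br_minus_right = bilinear_map_minus_right[OF T.module_axioms T.module_axioms br_bilinear]
lemmas br_hom_intros = bilinear_map_left[OF br_bilinear] bilinear_map_right[OF br_bilinear]
  module_hom_ident module_hom_plus[OF T.module_axioms] module_hom_const_zero[OF T.module_axioms]

lemma br_antisym:
  assumes x: "x \<in> carrier T" and y: "y \<in> carrier T"
  shows "br x y \<oplus>\<^bsub>T\<^esub> br y x = \<zero>\<^bsub>T\<^esub>"
proof (rule tensor_extension_unique[OF A.module_axioms B.module_axioms T.module_axioms _ _ _ x y])
  show "bilinear_map K T T T (\<lambda>x y. br x y \<oplus>\<^bsub>T\<^esub> br y x)" "bilinear_map K T T T (\<lambda>x y. \<zero>\<^bsub>T\<^esub>)"
    unfolding bilinear_map_def by (auto intro!: br_hom_intros)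
  show "br (a \<otimes>\<^sub>T a') (b \<otimes>\<^sub>T b') \<oplus>\<^bsub>T\<^esub> br (b \<otimes>\<^sub>T b') (a \<otimes>\<^sub>T a') = \<zero>\<^bsub>T\<^esub>"
    if "a \<in> carrier A" "a' \<in> carrier B" "b \<in> carrier A" "b' \<in> carrier B" for a a' b b'
    using that
    by (simp add: br_pure circ_closed diamond_closed pure_closed T.diff_normalize T.diff_eq_iff T.a_ac)
qed

text \<open>
  Antisymmetry does not give this in characteristic two. The bracket vanishes on the diagonal at pure
  tensors, and \<open>[u + v, u + v] = [u, u] + ([u, v] + [v, u]) + [v, v]\<close> shows that the property
  passes to sums.
\<close>

lemma br_self:
  assumes x: "x \<in> carrier T"
  shows "br x x = \<zero>\<^bsub>T\<^esub>"
proof -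
  note hom = br_bilinear[unfolded bilinear_map_def]
  have "x \<in> {x \<in> carrier T. br x x = \<zero>\<^bsub>T\<^esub>}"
  proof (rule tensor_space_induct[OF A.module_axioms B.module_axioms _ _ x])
    show "lincomb_closed_set K T {x \<in> carrier T. br x x = \<zero>\<^bsub>T\<^esub>}"
      unfolding lincomb_closed_set_def
    proof (intro conjI ballI)
      show "\<zero>\<^bsub>T\<^esub> \<in> {x \<in> carrier T. br x x = \<zero>\<^bsub>T\<^esub>}"
        using module_hom_zero[OF T.module_axioms T.module_axioms] hom by auto
    next
      fix u v assume "u \<in> {x \<in> carrier T. br x x = \<zero>\<^bsub>T\<^esub>}" "v \<in> {x \<in> carrier T. br x x = \<zero>\<^bsub>T\<^esub>}"
      hence u: "u \<in> carrier T" "br u u = \<zero>\<^bsub>T\<^esub>" and v: "v \<in> carrier T" "br v v = \<zero>\<^bsub>T\<^esub>" by auto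
      have "br (u \<oplus>\<^bsub>T\<^esub> v) (u \<oplus>\<^bsub>T\<^esub> v) = br u (u \<oplus>\<^bsub>T\<^esub> v) \<oplus>\<^bsub>T\<^esub> br v (u \<oplus>\<^bsub>T\<^esub> v)"
        using module_hom_add[of "\<lambda>x. br x (u \<oplus>\<^bsub>T\<^esub> v)" K T T u v] hom u v by simp
      also have "\<dots> = \<zero>\<^bsub>T\<^esub>"
        using module_hom_add[of "br u" K T T u v] module_hom_add[of "br v" K T T u v] hom u v
          br_antisym[OF u(1) v(1)]
        by (simp add: br_closed)
      finally show "u \<oplus>\<^bsub>T\<^esub> v \<in> {x \<in> carrier T. br x x = \<zero>\<^bsub>T\<^esub>}" using u v by simp
    next
      fix c u assume c: "c \<in> carrier K" and "u \<in> {x \<in> carrier T. br x x = \<zero>\<^bsub>T\<^esub>}"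
      thus "c \<odot>\<^bsub>T\<^esub> u \<in> {x \<in> carrier T. br x x = \<zero>\<^bsub>T\<^esub>}"
        using module_hom_smult[of "\<lambda>x. br x (c \<odot>\<^bsub>T\<^esub> u)" K T T c u] module_hom_smult[of "br u" K T T c u] hom
        by auto
    qed
  next
    fix a a' assume "a \<in> carrier A" "a' \<in> carrier B"
    thus "a \<otimes>\<^sub>T a' \<in> {x \<in> carrier T. br x x = \<zero>\<^bsub>T\<^esub>}"
      by (simp add: br_pure circ_closed diamond_closed pure_closed T.diff_eq_iff)
  qed
  thus ?thesis by simp
qed

text \<open>
  After rewriting with the normal forms of the two factors, each double bracket is a difference
  of sums of the tensors \<open>r \<otimes> s\<close>, \<open>r \<otimes> n\<close> and \<open>m \<otimes> s\<close>, and in the cyclic sum each of them occurs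
  equally often with either sign.
\<close>

lemma br_jacobi:
  assumes x: "x \<in> carrier T" and y: "y \<in> carrier T" and z: "z \<in> carrier T"
  shows "br x (br y z) \<oplus>\<^bsub>T\<^esub> br y (br z x) \<oplus>\<^bsub>T\<^esub> br z (br x y) = \<zero>\<^bsub>T\<^esub>"
proof (rule trilinear_eqI[OF T.module_axioms _ _ _ _ _ _ _ x y z])
  fix a a' b b' c c'
  assume a: "a \<in> carrier A" and a': "a' \<in> carrier B" and b: "b \<in> carrier A" and b': "b' \<in> carrier B"
    and c: "c \<in> carrier A" and c': "c' \<in> carrier B"
  obtain r\<^sub>a r\<^sub>b r\<^sub>c m\<^sub>a m\<^sub>b m\<^sub>c where A_cl: "r\<^sub>a \<in> carrier A" "r\<^sub>b \<in> carrier A" "r\<^sub>c \<in> carrier A"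
      "m\<^sub>a \<in> carrier A" "m\<^sub>b \<in> carrier A" "m\<^sub>c \<in> carrier A"
    and A_nf: "(a \<star> b) \<star> c = r\<^sub>a" "(a \<star> c) \<star> b = r\<^sub>a" "(b \<star> a) \<star> c = r\<^sub>b"
      "(b \<star> c) \<star> a = r\<^sub>b" "(c \<star> a) \<star> b = r\<^sub>c" "(c \<star> b) \<star> a = r\<^sub>c"
      "a \<star> (b \<star> c) = r\<^sub>a \<oplus>\<^bsub>A\<^esub> m\<^sub>c" "b \<star> (a \<star> c) = r\<^sub>b \<oplus>\<^bsub>A\<^esub> m\<^sub>c"
      "a \<star> (c \<star> b) = r\<^sub>a \<oplus>\<^bsub>A\<^esub> m\<^sub>b" "c \<star> (a \<star> b) = r\<^sub>c \<oplus>\<^bsub>A\<^esub> m\<^sub>b"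
      "b \<star> (c \<star> a) = r\<^sub>b \<oplus>\<^bsub>A\<^esub> m\<^sub>a" "c \<star> (b \<star> a) = r\<^sub>c \<oplus>\<^bsub>A\<^esub> m\<^sub>a"
    by (rule A.cubic_normal_form[OF a b c])
  obtain s\<^sub>a s\<^sub>b s\<^sub>c n\<^sub>a n\<^sub>b n\<^sub>c where B_cl: "s\<^sub>a \<in> carrier B" "s\<^sub>b \<in> carrier B" "s\<^sub>c \<in> carrier B"
      "n\<^sub>a \<in> carrier B" "n\<^sub>b \<in> carrier B" "n\<^sub>c \<in> carrier B"
    and B_nf: "c' \<diamondop> (b' \<diamondop> a') = s\<^sub>a" "b' \<diamondop> (c' \<diamondop> a') = s\<^sub>a" "c' \<diamondop> (a' \<diamondop> b') = s\<^sub>b"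
      "a' \<diamondop> (c' \<diamondop> b') = s\<^sub>b" "b' \<diamondop> (a' \<diamondop> c') = s\<^sub>c" "a' \<diamondop> (b' \<diamondop> c') = s\<^sub>c"
      "(c' \<diamondop> b') \<diamondop> a' = s\<^sub>a \<oplus>\<^bsub>B\<^esub> n\<^sub>c" "(c' \<diamondop> a') \<diamondop> b' = s\<^sub>b \<oplus>\<^bsub>B\<^esub> n\<^sub>c"
      "(b' \<diamondop> c') \<diamondop> a' = s\<^sub>a \<oplus>\<^bsub>B\<^esub> n\<^sub>b" "(b' \<diamondop> a') \<diamondop> c' = s\<^sub>c \<oplus>\<^bsub>B\<^esub> n\<^sub>b"
      "(a' \<diamondop> c') \<diamondop> b' = s\<^sub>b \<oplus>\<^bsub>B\<^esub> n\<^sub>a" "(a' \<diamondop> b') \<diamondop> c' = s\<^sub>c \<oplus>\<^bsub>B\<^esub> n\<^sub>a"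
    by (rule B.cubic_normal_form[OF a' b' c'])
  show "br (a \<otimes>\<^sub>T a') (br (b \<otimes>\<^sub>T b') (c \<otimes>\<^sub>T c')) \<oplus>\<^bsub>T\<^esub> br (b \<otimes>\<^sub>T b') (br (c \<otimes>\<^sub>T c') (a \<otimes>\<^sub>T a'))
      \<oplus>\<^bsub>T\<^esub> br (c \<otimes>\<^sub>T c') (br (a \<otimes>\<^sub>T a') (b \<otimes>\<^sub>T b')) = \<zero>\<^bsub>T\<^esub>"
    using a a' b b' c c' A_cl B_cl
    by (simp add: br_pure br_minus_right circ_closed diamond_closed pure_closed A_nf B_nf
        pure_add_left pure_add_right T.diff_normalize T.diff_eq_iff T.a_ac)
qed (auto intro!: br_hom_intros br_closed)

end


section \<open>The associative product\<close>

locale tensor_of_algebras = A: algebra K A + B: algebra K B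
  for K :: "('k, 'r) ring_scheme"
    and A :: "('k, 'a, 'm) module_scheme" and B :: "('k, 'b, 'n) module_scheme"
begin

sublocale tensor_of_modules K A B ..

abbreviation (input) "J \<equiv> tensor_algebra K A B"

lemmas mult_bilinear =
  tensor_algebra_mult(1)[OF A.module_axioms B.module_axioms A.mult_bilinear B.mult_bilinear]
lemmas mult_pure =
  tensor_algebra_mult(2)[OF A.module_axioms B.module_axioms A.mult_bilinear B.mult_bilinear]
lemmas mult_closed = bilinear_map_closed[OF mult_bilinear]
lemmas mult_minus_left = bilinear_map_minus_left[OF T.module_axioms T.module_axioms mult_bilinear]
lemmas mult_minus_right = bilinear_map_minus_right[OF T.module_axioms T.module_axioms mult_bilinear]
lemmas mult_hom_intros = bilinear_map_left[OF mult_bilinear] bilinear_map_right[OF mult_bilinear]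
  module_hom_ident module_hom_plus[OF T.module_axioms]

lemma tensor_algebra_algebra: "algebra K J"
proof -
  interpret J: module K J by (rule tensor_algebra_module)
  have comm: "x \<otimes>\<^bsub>J\<^esub> y = y \<otimes>\<^bsub>J\<^esub> x" if "x \<in> carrier T" "y \<in> carrier T" for x y
    by (rule tensor_extension_unique[OF A.module_axioms B.module_axioms T.module_axioms
          mult_bilinear bilinear_map_flip[OF mult_bilinear] _ that])
       (simp add: mult_pure A.m_comm B.m_comm)
  have assoc: "(x \<otimes>\<^bsub>J\<^esub> y) \<otimes>\<^bsub>J\<^esub> z = x \<otimes>\<^bsub>J\<^esub> (y \<otimes>\<^bsub>J\<^esub> z)"
    if "x \<in> carrier T" "y \<in> carrier T" "z \<in> carrier T" for x y z
    by (rule trilinear_eqI[OF T.module_axioms _ _ _ _ _ _ _ that])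
       (auto intro!: mult_hom_intros mult_closed simp: mult_pure A.m_assoc B.m_assoc)
  have one: "\<one>\<^bsub>J\<^esub> \<otimes>\<^bsub>J\<^esub> x = x" if "x \<in> carrier T" for x
    by (rule hom_eqI[OF T.module_axioms _ _ _ that])
       (auto intro!: mult_hom_intros pure_closed simp: tensor_algebra_simps mult_pure)
  have monoid: "comm_monoid J"
  proof (rule comm_monoidI)
    show "\<one>\<^bsub>J\<^esub> \<in> carrier J" by (simp add: tensor_algebra_simps pure_closed)
    show "x \<otimes>\<^bsub>J\<^esub> y = y \<otimes>\<^bsub>J\<^esub> x" if "x \<in> carrier J" "y \<in> carrier J" for x y
      using that by (simp only: tensor_algebra_simps(1) comm)
  qed (simp_all add: tensor_algebra_simps(1) mult_closed assoc one)
  have "cring J"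
  proof (rule cringI[OF J.abelian_group_axioms monoid])
    fix x y z assume "x \<in> carrier J" "y \<in> carrier J" "z \<in> carrier J"
    thus "(x \<oplus>\<^bsub>J\<^esub> y) \<otimes>\<^bsub>J\<^esub> z = x \<otimes>\<^bsub>J\<^esub> z \<oplus>\<^bsub>J\<^esub> y \<otimes>\<^bsub>J\<^esub> z"
      using module_hom_add[of "\<lambda>x. x \<otimes>\<^bsub>J\<^esub> z" K T T x y] mult_bilinear
      by (simp add: tensor_algebra_simps bilinear_map_def)
  qed
  moreover have "(c \<odot>\<^bsub>J\<^esub> x) \<otimes>\<^bsub>J\<^esub> y = c \<odot>\<^bsub>J\<^esub> (x \<otimes>\<^bsub>J\<^esub> y)"
    if "c \<in> carrier K" "x \<in> carrier J" "y \<in> carrier J" for c x y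
    using module_hom_smult[of "\<lambda>x. x \<otimes>\<^bsub>J\<^esub> y" K T T c x] mult_bilinear that
    by (simp add: tensor_algebra_simps bilinear_map_def)
  ultimately show ?thesis
    by (intro algebraI) (simp_all add: A.R_cring J.smult_l_distr J.smult_r_distr J.smult_assoc1)
qed

end

section \<open>The Jacobi algebra\<close>

lemma (in jacobi_novikov_poisson_algebra) circ_eq_mult:
  "\<lbrakk>x \<in> carrier A; a \<in> carrier A\<rbrakk> \<Longrightarrow> x \<star> a = x \<otimes> (\<one> \<star> a)"
  using mult_circ[of x \<one> a] by simp

text \<open>
  The right multiplication by \<open>a\<close> is the associative multiplication by \<open>p = 1 \<star> a\<close>, while the left
  multiplication by \<open>a\<close> obeys a Leibniz rule with correction \<open>q = a \<star> 1\<close>. Naming \<open>p\<close>, \<open>q\<close>, \<open>u\<close>,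
  \<open>v\<close> leaves only the commutative product to be compared.
\<close>

lemma (in jacobi_novikov_poisson_algebra) circ_normal_form:
  assumes a: "a \<in> carrier A" and b: "b \<in> carrier A" and c: "c \<in> carrier A"
  obtains p q u v where "p \<in> carrier A" "q \<in> carrier A" "u \<in> carrier A" "v \<in> carrier A"
    and "\<one> \<star> a = p" "a \<star> \<one> = q" "a \<star> b = u" "a \<star> c = v"
    and "b \<star> a = b \<otimes> p" "c \<star> a = c \<otimes> p" "(b \<otimes> c) \<star> a = b \<otimes> c \<otimes> p"
    and "a \<star> (b \<otimes> c) = (u \<otimes> c \<oplus> b \<otimes> v) \<ominus> b \<otimes> c \<otimes> q"
  by (rule that[of "\<one> \<star> a" "a \<star> \<one>" "a \<star> b" "a \<star> c"])
     (use a b c in \<open>simp_all add: bilinear_map_closed[OF circ_bilinear] circ_mult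
        circ_eq_mult[of b a] circ_eq_mult[of c a] circ_eq_mult[of "b \<otimes> c" a]\<close>)

locale tensor_of_jacobi_novikov_poisson_algebras =
  A: jacobi_novikov_poisson_algebra K A circ +
  B: jacobi_novikov_poisson_algebra K B "\<lambda>a b. diamond b a"
  for K :: "('k, 'r) ring_scheme"
    and A :: "('k, 'a, 'm) module_scheme" and B :: "('k, 'b, 'n) module_scheme"
    and circ :: "'a \<Rightarrow> 'a \<Rightarrow> 'a" (infixl "\<star>" 70) and diamond :: "'b \<Rightarrow> 'b \<Rightarrow> 'b" (infixl "\<diamondop>" 70)
begin

sublocale tensor_of_novikov_algebras K A B circ diamond ..
sublocale tensor_of_algebras K A B ..

text \<open>
  With \<open>p\<close>, \<open>q\<close> as in \<open>circ_normal_form\<close> and \<open>p'\<close>, \<open>q'\<close> their counterparts in \<open>B\<close>, the two Leibniz rules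
  leave the corrections \<open>- b c q \<otimes> b' c' p'\<close> and \<open>b c p \<otimes> b' c' q'\<close>; they are the
  product of \<open>b c \<otimes> b' c'\<close> with \<open>[1, a \<otimes> a'] = p \<otimes> q' - q \<otimes> p'\<close>.
\<close>

lemma br_mult:
  assumes x: "x \<in> carrier T" and y: "y \<in> carrier T" and z: "z \<in> carrier T"
  shows "br x (y \<otimes>\<^bsub>J\<^esub> z) =
    br x y \<otimes>\<^bsub>J\<^esub> z \<oplus>\<^bsub>T\<^esub> y \<otimes>\<^bsub>J\<^esub> br x z \<oplus>\<^bsub>T\<^esub> (y \<otimes>\<^bsub>J\<^esub> z) \<otimes>\<^bsub>J\<^esub> br \<one>\<^bsub>J\<^esub> x"
proof (rule trilinear_eqI[OF T.module_axioms _ _ _ _ _ _ _ x y z])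
  fix a a' b b' c c'
  assume a: "a \<in> carrier A" and a': "a' \<in> carrier B" and b: "b \<in> carrier A" and b': "b' \<in> carrier B"
    and c: "c \<in> carrier A" and c': "c' \<in> carrier B"
  obtain p q u v where A_cl: "p \<in> carrier A" "q \<in> carrier A" "u \<in> carrier A" "v \<in> carrier A"
    and A_nf: "\<one>\<^bsub>A\<^esub> \<star> a = p" "a \<star> \<one>\<^bsub>A\<^esub> = q" "a \<star> b = u" "a \<star> c = v"
      "b \<star> a = b \<otimes>\<^bsub>A\<^esub> p" "c \<star> a = c \<otimes>\<^bsub>A\<^esub> p" "(b \<otimes>\<^bsub>A\<^esub> c) \<star> a = b \<otimes>\<^bsub>A\<^esub> c \<otimes>\<^bsub>A\<^esub> p"
      "a \<star> (b \<otimes>\<^bsub>A\<^esub> c) = (u \<otimes>\<^bsub>A\<^esub> c \<oplus>\<^bsub>A\<^esub> b \<otimes>\<^bsub>A\<^esub> v) \<ominus>\<^bsub>A\<^esub> b \<otimes>\<^bsub>A\<^esub> c \<otimes>\<^bsub>A\<^esub> q"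
    by (rule A.circ_normal_form[OF a b c])
  obtain p' q' u' v' where B_cl: "p' \<in> carrier B" "q' \<in> carrier B" "u' \<in> carrier B" "v' \<in> carrier B"
    and B_nf: "a' \<diamondop> \<one>\<^bsub>B\<^esub> = p'" "\<one>\<^bsub>B\<^esub> \<diamondop> a' = q'" "b' \<diamondop> a' = u'" "c' \<diamondop> a' = v'"
      "a' \<diamondop> b' = b' \<otimes>\<^bsub>B\<^esub> p'" "a' \<diamondop> c' = c' \<otimes>\<^bsub>B\<^esub> p'" "a' \<diamondop> (b' \<otimes>\<^bsub>B\<^esub> c') = b' \<otimes>\<^bsub>B\<^esub> c' \<otimes>\<^bsub>B\<^esub> p'"
      "(b' \<otimes>\<^bsub>B\<^esub> c') \<diamondop> a' = (u' \<otimes>\<^bsub>B\<^esub> c' \<oplus>\<^bsub>B\<^esub> b' \<otimes>\<^bsub>B\<^esub> v') \<ominus>\<^bsub>B\<^esub> b' \<otimes>\<^bsub>B\<^esub> c' \<otimes>\<^bsub>B\<^esub> q'"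
    by (rule B.circ_normal_form[OF a' b' c'])
  show "br (a \<otimes>\<^sub>T a') ((b \<otimes>\<^sub>T b') \<otimes>\<^bsub>J\<^esub> (c \<otimes>\<^sub>T c')) =
      br (a \<otimes>\<^sub>T a') (b \<otimes>\<^sub>T b') \<otimes>\<^bsub>J\<^esub> (c \<otimes>\<^sub>T c') \<oplus>\<^bsub>T\<^esub> (b \<otimes>\<^sub>T b') \<otimes>\<^bsub>J\<^esub> br (a \<otimes>\<^sub>T a') (c \<otimes>\<^sub>T c')
      \<oplus>\<^bsub>T\<^esub> ((b \<otimes>\<^sub>T b') \<otimes>\<^bsub>J\<^esub> (c \<otimes>\<^sub>T c')) \<otimes>\<^bsub>J\<^esub> br \<one>\<^bsub>J\<^esub> (a \<otimes>\<^sub>T a')"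
    using a a' b b' c c' A_cl B_cl
    by (simp add: tensor_algebra_simps(5) br_pure mult_pure mult_minus_left mult_minus_right
        pure_closed A_nf B_nf pure_add_left pure_add_right pure_minus_left pure_minus_right
        A.m_ac B.m_ac T.diff_normalize T.diff_eq_iff T.a_ac)
qed (auto intro!: br_hom_intros mult_hom_intros br_closed mult_closed pure_closed
      simp: tensor_algebra_simps(5))

lemma tensor_jacobi_algebra: "jacobi_algebra K J br"
proof (intro jacobi_algebra.intro tensor_algebra_algebra lie_algebra.intro vectorspace.intro
    tensor_algebra_module A.field_axioms lie_algebra_axioms.intro jacobi_algebra_axioms.intro)
  show "bilinear_map K J J J br" using br_bilinear by (simp add: tensor_algebra_bilinear)
qed (simp_all add: tensor_algebra_simps(1-4) br_self br_jacobi br_mult)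

end

section \<open>The form\<close>

lemma ground_module_simps:
  "carrier (ground_module K) = carrier K" "\<zero>\<^bsub>ground_module K\<^esub> = \<zero>\<^bsub>K\<^esub>"
  "x \<oplus>\<^bsub>ground_module K\<^esub> y = x \<oplus>\<^bsub>K\<^esub> y" "c \<odot>\<^bsub>ground_module K\<^esub> x = c \<otimes>\<^bsub>K\<^esub> x"
  "x \<ominus>\<^bsub>ground_module K\<^esub> y = x \<ominus>\<^bsub>K\<^esub> y"
  by (simp_all add: ground_module_def a_minus_def a_inv_def m_inv_def)

locale tensor_of_forms =
  A: nondegenerate_symmetric_form K A formA + B: nondegenerate_symmetric_form K B formB
  for K :: "('k, 'r) ring_scheme"
    and A :: "('k, 'a, 'm) module_scheme" and B :: "('k, 'b, 'n) module_scheme"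
    and formA :: "'a \<Rightarrow> 'a \<Rightarrow> 'k" and formB :: "'b \<Rightarrow> 'b \<Rightarrow> 'k"
begin

sublocale tensor_of_modules K A B ..

abbreviation (input) fm where "fm \<equiv> tensor_form K A B formA formB"

lemma ground: "module K (ground_module K)"
  by (rule ground_module_is_module[OF A.module_axioms B.module_axioms])

lemmas fm_bilinear =
  tensor_form(1)[OF A.module_axioms B.module_axioms A.form_bilinear B.form_bilinear]
lemmas fm_pure =
  tensor_form(2)[OF A.module_axioms B.module_axioms A.form_bilinear B.form_bilinear]
lemmas fm_closed = bilinear_map_closed[OF fm_bilinear, unfolded ground_module_simps]
lemmas formA_closed = bilinear_map_closed[OF A.form_bilinear, unfolded ground_module_simps]
lemmas fm_minus_left =
  bilinear_map_minus_left[OF T.module_axioms ground fm_bilinear, unfolded ground_module_simps]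
lemmas fm_minus_right =
  bilinear_map_minus_right[OF T.module_axioms ground fm_bilinear, unfolded ground_module_simps]
lemmas fm_hom_intros = bilinear_map_left[OF fm_bilinear] bilinear_map_right[OF fm_bilinear]

lemma fm_sym:
  assumes "x \<in> carrier T" and "y \<in> carrier T"
  shows "fm x y = fm y x"
  by (rule tensor_extension_unique[OF A.module_axioms B.module_axioms ground
        fm_bilinear bilinear_map_flip[OF fm_bilinear] _ assms])
     (simp add: fm_pure A.form_sym B.form_sym)

text \<open>
  The coefficients \<open>\<B> (\<alpha>\<^sub>s, a)\<close> of \<open>x = \<Sum> \<alpha>\<^sub>s \<otimes> s\<close> turn orthogonality of \<open>x\<close> to all
  \<open>a \<otimes> b\<close>, for a fixed \<open>a\<close>, into orthogonality of a vector of \<open>B\<close> to all \<open>b\<close>.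
\<close>

lemma fm_nondegenerate:
  assumes fin: "B.fin_dim" and x: "x \<in> carrier T" and orth: "\<And>y. y \<in> carrier T \<Longrightarrow> fm x y = \<zero>\<^bsub>K\<^esub>"
  shows "x = \<zero>\<^bsub>T\<^esub>"
proof -
  obtain S where S: "finite S" "S \<subseteq> carrier B" "B.span S = carrier B" "B.lin_indpt S"
    using B.finite_basis_exists[OF fin] unfolding B.basis_def by auto
  obtain \<alpha> where \<alpha>: "\<alpha> \<in> S \<rightarrow> carrier A" and x_eq: "x = (\<Oplus>\<^bsub>T\<^esub>s\<in>S. \<alpha> s \<otimes>\<^sub>T s)"
    by (rule tensor_representation[OF S(1-3) x])
  interpret G: module K "ground_module K" by (rule ground)
  have "\<alpha> s = \<zero>\<^bsub>A\<^esub>" if s: "s \<in> S" for s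
  proof (rule A.form_nondegenerate)
    show "\<alpha> s \<in> carrier A" using \<alpha> s by auto
    fix a assume a: "a \<in> carrier A"
    define d where "d s = formA (\<alpha> s) a" for s
    have d: "d \<in> S \<rightarrow> carrier K" using \<alpha> a by (auto simp: d_def intro!: formA_closed)
    have "formB (B.lincomb d S) b = \<zero>\<^bsub>K\<^esub>" if b: "b \<in> carrier B" for b
    proof -
      have hom: "(\<lambda>v. formB v b) \<in> module_hom K B (ground_module K)"
        using B.form_bilinear b by (simp add: bilinear_map_def)
      have "formB (B.lincomb d S) b = finsum (ground_module K) (\<lambda>s. formB (d s \<odot>\<^bsub>B\<^esub> s) b) S"
        unfolding B.lincomb_def
        by (rule module_hom_finsum[OF B.module_axioms ground hom S(1)]) (use d S in auto)
      also have "\<dots> = finsum (ground_module K) (\<lambda>s. fm (\<alpha> s \<otimes>\<^sub>T s) (a \<otimes>\<^sub>T b)) S"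
      proof (rule G.add.finprod_cong')
        fix s assume "s \<in> S"
        hence "s \<in> carrier B" "\<alpha> s \<in> carrier A" "d s \<in> carrier K" using S \<alpha> d by auto
        thus "formB (d s \<odot>\<^bsub>B\<^esub> s) b = fm (\<alpha> s \<otimes>\<^sub>T s) (a \<otimes>\<^sub>T b)"
          using module_hom_smult[OF hom, of "d s" s] a b
          by (simp add: fm_pure d_def ground_module_simps)
      qed (use S \<alpha> a b in \<open>auto simp: ground_module_simps intro!: fm_closed pure_closed\<close>)
      also have "\<dots> = fm x (a \<otimes>\<^sub>T b)"
        unfolding x_eq
        by (rule module_hom_finsum[OF T.module_axioms ground _ S(1), symmetric])
           (use S \<alpha> a b in \<open>auto intro!: fm_hom_intros module_hom_ident pure_closed\<close>)
      also have "\<dots> = \<zero>\<^bsub>K\<^esub>" by (rule orth[OF pure_closed[OF a b]])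
      finally show ?thesis .
    qed
    hence "B.lincomb d S = \<zero>\<^bsub>B\<^esub>"
      using B.form_nondegenerate d S by auto
    hence "d s = \<zero>\<^bsub>K\<^esub>"
      using B.lin_dep_crit[OF S(1) subset_refl d s] S(4) by auto
    thus "formA (\<alpha> s) a = \<zero>\<^bsub>K\<^esub>" by (simp add: d_def)
  qed
  moreover have "\<zero>\<^bsub>A\<^esub> \<otimes>\<^sub>T s = \<zero>\<^bsub>T\<^esub>" if "s \<in> S" for s
    using module_hom_zero[OF A.module_axioms T.module_axioms, of "\<lambda>a. a \<otimes>\<^sub>T s"] that S
      pure_bilinear by (auto simp: bilinear_map_def)
  ultimately show ?thesis unfolding x_eq by (simp add: T.add.finprod_one_eqI)
qed

end

text \<open>
  Write \<open>f x y z\<close> for \<open>form x (y \<star> z)\<close>. Invariance reads \<open>f z x y + f y x z + f y z x = 0\<close>;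
  subtracting its instance with \<open>y\<close> and \<open>z\<close> exchanged gives \<open>f y z x = f z y x\<close>. So \<open>f\<close> depends
  only on its last argument, with values \<open>g\<close>, \<open>h\<close> and \<open>- (g + h)\<close> at \<open>a\<close>, \<open>b\<close> and \<open>c\<close>.
\<close>

lemma (in quadratic_jacobi_novikov_poisson_algebra) form_circ_normal_form:
  assumes a: "a \<in> carrier A" and b: "b \<in> carrier A" and c: "c \<in> carrier A"
  obtains g h where "g \<in> carrier K" "h \<in> carrier K"
    and "form (b \<star> a) c = g" "form a (c \<star> b) = h" "form (a \<star> b) c = h"
    and "form a (b \<star> c) = \<ominus>\<^bsub>K\<^esub> (g \<oplus>\<^bsub>K\<^esub> h)"
proof -
  note cl = bilinear_map_closed[OF circ_bilinear]
  note fcl = bilinear_map_closed[OF form_bilinear, unfolded ground_module_simps]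
  have add: "form x (y \<oplus> z) = form x y \<oplus>\<^bsub>K\<^esub> form x z"
    if "x \<in> carrier A" "y \<in> carrier A" "z \<in> carrier A" for x y z
    using that form_bilinear module_hom_add[of "form x" K A "ground_module K" y z]
    by (simp add: bilinear_map_def ground_module_simps)
  \<comment> \<open>the defining invariance, with the product moved to the second argument\<close>
  have inv: "form z (x \<star> y) = \<ominus>\<^bsub>K\<^esub> (form y (x \<star> z) \<oplus>\<^bsub>K\<^esub> form y (z \<star> x))"
    if "x \<in> carrier A" "y \<in> carrier A" "z \<in> carrier A" for x y z
    using form_circ[OF that] that by (simp add: cl add form_sym)
  have sym: "form y (z \<star> x) = form z (y \<star> x)"
    if "x \<in> carrier A" "y \<in> carrier A" "z \<in> carrier A" for x y z
  proof -
    have in_K: "form x' (y' \<star> z') \<in> carrier K"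
      if "x' \<in> carrier A" "y' \<in> carrier A" "z' \<in> carrier A" for x' y' z'
      using that by (simp add: cl fcl)
    have "(form z (x \<star> y) \<oplus>\<^bsub>K\<^esub> form y (x \<star> z)) \<oplus>\<^bsub>K\<^esub> form y (z \<star> x) = \<zero>\<^bsub>K\<^esub>"
      using inv[OF that] in_K that by (simp add: R.a_assoc R.l_neg)
    moreover have "(form z (x \<star> y) \<oplus>\<^bsub>K\<^esub> form y (x \<star> z)) \<oplus>\<^bsub>K\<^esub> form z (y \<star> x) = \<zero>\<^bsub>K\<^esub>"
      using inv[OF that(1,3,2)] in_K that
      by (simp add: R.a_comm[of "form z (x \<star> y)"] R.a_assoc R.l_neg)
    ultimately show ?thesis
      using in_K that by (metis R.a_closed R.add.m_comm R.minus_equality)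
  qed
  show thesis
    by (rule that[of "form c (b \<star> a)" "form c (a \<star> b)"])
       (use a b c inv[OF b c a] sym[of a b c] sym[of b c a] in \<open>auto simp: cl fcl form_sym R.a_comm\<close>)
qed

section \<open>The Frobenius Jacobi algebra\<close>

locale tensor_of_quadratic_algebras =
  A: quadratic_jacobi_novikov_poisson_algebra K A circ formA +
  B: quadratic_jacobi_novikov_poisson_algebra K B "\<lambda>a b. diamond b a" formB
  for K :: "('k, 'r) ring_scheme"
    and A :: "('k, 'a, 'm) module_scheme" and B :: "('k, 'b, 'n) module_scheme"
    and circ :: "'a \<Rightarrow> 'a \<Rightarrow> 'a" (infixl "\<star>" 70) and diamond :: "'b \<Rightarrow> 'b \<Rightarrow> 'b" (infixl "\<diamondop>" 70)
    and formA :: "'a \<Rightarrow> 'a \<Rightarrow> 'k" and formB :: "'b \<Rightarrow> 'b \<Rightarrow> 'k"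
begin

sublocale tensor_of_jacobi_novikov_poisson_algebras K A B circ diamond ..
sublocale tensor_of_forms K A B formA formB ..

lemma fm_mult:
  assumes x: "x \<in> carrier T" and y: "y \<in> carrier T" and z: "z \<in> carrier T"
  shows "fm (x \<otimes>\<^bsub>J\<^esub> y) z = fm x (y \<otimes>\<^bsub>J\<^esub> z)"
  by (rule trilinear_eqI[OF ground _ _ _ _ _ _ _ x y z])
     (auto intro!: fm_hom_intros mult_hom_intros mult_closed
       simp: mult_pure fm_pure A.form_mult B.form_mult)

lemma fm_bracket:
  assumes x: "x \<in> carrier T" and y: "y \<in> carrier T" and z: "z \<in> carrier T"
  shows "fm (br x y) z = fm x (br y z)"
proof (rule trilinear_eqI[OF ground _ _ _ _ _ _ _ x y z])
  fix a a' b b' c c'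
  assume a: "a \<in> carrier A" and a': "a' \<in> carrier B" and b: "b \<in> carrier A" and b': "b' \<in> carrier B"
    and c: "c \<in> carrier A" and c': "c' \<in> carrier B"
  obtain g h where A_cl: "g \<in> carrier K" "h \<in> carrier K"
    and A_nf: "formA (b \<star> a) c = g" "formA a (c \<star> b) = h" "formA (a \<star> b) c = h"
      "formA a (b \<star> c) = \<ominus>\<^bsub>K\<^esub> (g \<oplus>\<^bsub>K\<^esub> h)"
    by (rule A.form_circ_normal_form[OF a b c])
  obtain g' h' where B_cl: "g' \<in> carrier K" "h' \<in> carrier K"
    and B_nf: "formB (a' \<diamondop> b') c' = g'" "formB a' (b' \<diamondop> c') = h'" "formB (b' \<diamondop> a') c' = h'"
      "formB a' (c' \<diamondop> b') = \<ominus>\<^bsub>K\<^esub> (g' \<oplus>\<^bsub>K\<^esub> h')"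
    by (rule B.form_circ_normal_form[OF a' b' c'])
  \<comment> \<open>expanding the right-hand side, the two terms \<open>h h'\<close> cancel\<close>
  have "h \<otimes>\<^bsub>K\<^esub> g' \<ominus>\<^bsub>K\<^esub> g \<otimes>\<^bsub>K\<^esub> h' =
      (\<ominus>\<^bsub>K\<^esub> (g \<oplus>\<^bsub>K\<^esub> h)) \<otimes>\<^bsub>K\<^esub> h' \<ominus>\<^bsub>K\<^esub> h \<otimes>\<^bsub>K\<^esub> (\<ominus>\<^bsub>K\<^esub> (g' \<oplus>\<^bsub>K\<^esub> h'))"
    using A_cl B_cl by algebra
  thus "fm (br (a \<otimes>\<^sub>T a') (b \<otimes>\<^sub>T b')) (c \<otimes>\<^sub>T c') = fm (a \<otimes>\<^sub>T a') (br (b \<otimes>\<^sub>T b') (c \<otimes>\<^sub>T c'))"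
    using a a' b b' c c'
    by (simp add: br_pure circ_closed diamond_closed pure_closed fm_minus_left fm_minus_right
        fm_pure A_nf B_nf)
qed (auto intro!: fm_hom_intros br_hom_intros br_closed)

lemma tensor_frobenius_jacobi_algebra:
  assumes finA: "A.fin_dim" and finB: "B.fin_dim"
  shows "frobenius_jacobi_algebra K J br fm"
proof (intro frobenius_jacobi_algebra.intro tensor_jacobi_algebra nondegenerate_symmetric_form.intro
    vectorspace.intro tensor_algebra_module A.field_axioms nondegenerate_symmetric_form_axioms.intro
    frobenius_jacobi_algebra_axioms.intro)
  show "bilinear_map K J J (ground_module K) fm"
    using fm_bilinear by (simp add: tensor_algebra_bilinear)
  have vs: "vectorspace K J" by (intro vectorspace.intro tensor_algebra_module A.field_axioms)
  obtain E where E: "finite E" "E \<subseteq> carrier A" "A.span E = carrier A"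
    using finA unfolding A.fin_dim_def by auto
  obtain F where F: "finite F" "F \<subseteq> carrier B" "B.span F = carrier B"
    using finB unfolding B.fin_dim_def by auto
  show "vectorspace.fin_dim K J"
    unfolding vectorspace.fin_dim_def[OF vs] tensor_algebra_span tensor_algebra_simps
    using tensor_space_span[OF E(2,3) F(2,3)] E F
    by (intro exI[of _ "(\<lambda>(a, b). a \<otimes>\<^sub>T b) ` (E \<times> F)"]) (auto intro!: pure_closed)
qed (simp_all add: tensor_algebra_simps(1,2) fm_sym fm_nondegenerate[OF finB] fm_mult fm_bracket)

end

theorem theorem3p13:
  fixes K :: "('k, 'r) ring_scheme"
    and A :: "('k, 'a, 'm) module_scheme" and B :: "('k, 'b, 'n) module_scheme"
    and circ :: "'a \<Rightarrow> 'a \<Rightarrow> 'a" and diamond :: "'b \<Rightarrow> 'b \<Rightarrow> 'b"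
    and formA :: "'a \<Rightarrow> 'a \<Rightarrow> 'k" and formB :: "'b \<Rightarrow> 'b \<Rightarrow> 'k"
  assumes "field K"
    and "quadratic_jacobi_novikov_poisson_algebra K A circ formA"
    and "vectorspace.fin_dim K A"
    and "quadratic_right_jacobi_novikov_poisson_algebra K B diamond formB"
    and "vectorspace.fin_dim K B"
  shows "frobenius_jacobi_algebra K (tensor_algebra K A B)
           (tensor_bracket K A B circ diamond) (tensor_form K A B formA formB)"
proof -
  interpret tensor_of_quadratic_algebras K A B circ diamond formA formB
    using assms(2,4)
    by (simp add: tensor_of_quadratic_algebras_def quadratic_right_jacobi_novikov_poisson_algebra_def)
  show ?thesis by (rule tensor_frobenius_jacobi_algebra[OF assms(3,5)])
qed

end
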